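(* Suppose $n$ is an odd integer with $t_1\leq n<\min\{t_2,t_3\}$, and put $K=k_1+k_2+k_3$. Then: (i) the $\mathfrak{BI}$-module $\mathscr M_n(x_1)$ is isomorphic to $W_1\oplus W_1$, where $W_1=O_{n-t_1}\big(k_2+\tfrac{n+1}{2},\,-K-\tfrac{n+1}{2},\,-k_3-\tfrac{n+1}{2}\big)^{((-1,-1),(1\,2\,3))}$; (ii) the $\mathfrak{BI}$-module $\mathscr M_n/\mathscr M_n(x_1)$ is isomorphic to $W_2\oplus W_2$, where $W_2=O_{t_1-1}(k_2,\,-K-n-1,\,k_3)^{(1\,2\,3)}$. Moreover, if $k_2,k_3\geq0$, then $W_1,W_2$ are irreducible and isomorphic to $O_{n-t_1}\big(K+\tfrac{n+1}{2},\,-k_3-\tfrac{n+1}{2},\,-k_2-\tfrac{n+1}{2}\big)$ and $O_{t_1-1}(-K-n-1,\,k_3,\,k_2)$, respectively.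
   Context: Fix real numbers $k_1,k_2,k_3$. For $i=1,2,3$ let $R_i$ be the operator on functions on $\mathbb R^3$ replacing $x_i$ by $-x_i$, and $T_if=\frac{\partial f}{\partial x_i}+k_i\frac{f-R_if}{x_i}$ (Dunkl operators). Let $\sigma_1=\begin{pmatrix}0&1\\1&0\end{pmatrix}$, $\sigma_2=\begin{pmatrix}0&-\sqrt{-1}\\ \sqrt{-1}&0\end{pmatrix}$, $\sigma_3=\begin{pmatrix}1&0\\0&-1\end{pmatrix}$, and let $e_i$ act on $\mathbb C^2$ by $\sigma_i$. Tensor products are over $\mathbb R$; $\mathbb R[\cdots]_m$ denotes homogeneous polynomials of degree $m$. Let $\mathbf D=e_1\otimes T_1+e_2\otimes T_2+e_3\otimes T_3$ and $\mathscr M_n=\ker(\mathbf D|_{\mathbb C^2\otimes\mathbb R[x_1,x_2,x_3]_n})$. For $i=1,2,3$ set $t_i=-2k_i$ if $2k_i$ is an odd negative integer, and $t_i=\infty$ otherwise. For $i=1,2,3$, $\mathscr M_n(x_i)=\mathscr M_n\cap\bigoplus_{j=t_i}^n\mathbb C^2\otimes(x_i^j\cdot\mathbb R[x_p,x_q]_{n-j})$ where $\{p,q\}=\{1,2,3\}\setminus\{i\}$ (it is $\{0\}$ if $n<t_i$); it is a $\mathfrak{BI}$-submodule of $\mathscr M_n$. $\mathfrak{BI}$ is the unital associative $\mathbb C$-algebra generated by $X,Y,Z$ with relations saying that $\{X,Y\}-Z$, $\{Y,Z\}-X$, $\{Z,X\}-Y$ commute with $X,Y,Z$ ($\{A,B\}=AB+BA$).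 $\mathscr M_n$ is a $\mathfrak{BI}$-module via $X=(\sqrt{-1}\,e_1\otimes(x_3T_2-x_2T_3)+\tfrac12)R_2R_3+k_2R_3+k_3R_2$, $Y=(\sqrt{-1}\,e_2\otimes(x_1T_3-x_3T_1)+\tfrac12)R_1R_3+k_3R_1+k_1R_3$, $Z=(\sqrt{-1}\,e_3\otimes(x_2T_1-x_1T_2)+\tfrac12)R_1R_2+k_1R_2+k_2R_1$, operators composed right to left, $R_i$ acting on the polynomial factor. Twisting: for a $\mathfrak{BI}$-module $V$ and algebra automorphism $\varepsilon$, $V^\varepsilon$ is $V$ with action $x\cdot v=\varepsilon(x)v$. Write $(W_1,W_2,W_3)=(X,Y,Z)$. A permutation $\sigma\in\mathfrak S_3$ denotes the automorphism $W_i\mapsto W_{\sigma(i)}$; the sign automorphisms are $(1,-1)\colon X\mapsto X,Y\mapsto -Y,Z\mapsto -Z$; $(-1,1)\colon X\mapsto -X,Y\mapsto Y,Z\mapsto -Z$; $(-1,-1)\colon X\mapsto -X,Y\mapsto -Y,Z\mapsto Z$; a pair $(\epsilon,\sigma)$ denotes the composite $\epsilon\circ\sigma$. For $a,b,c\in\mathbb C$ and even $d\geq0$, $O_d(a,b,c)$ is the $\mathfrak{BI}$-module $\mathbb C^{d+1}$ in which, w.r.t. a basis $v_0,\dots,v_d$, $X$ acts by the lower bidiagonal matrix with diagonal $(\theta_0,\dots,\theta_d)$ and subdiagonal entries $1$, $Y$ by the upper bidiagonal matrix with diagonal $(\theta^*_0,\dots,\theta^*_d)$ and superdiagonal $(\varphi_1,\dots,\varphi_d)$,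 and $Z=\{X,Y\}-(2ab-c(d+1))$, where $\theta_i=\frac{(-1)^i(2a-d+2i)}{2}$, $\theta^*_i=\frac{(-1)^i(2b-d+2i)}{2}$, $\varphi_i=\frac{i(d+1-2i-2a-2b-2c)}{2}$ ($i$ even), $\varphi_i=\frac{(i-d-1)(d+1-2i-2a-2b+2c)}{2}$ ($i$ odd). *)

theory Defs
  imports Complex_Main "HOL-Library.Extended_Nat"
begin

type_synonym 'i vec = "'i \<Rightarrow> complex"

definition vzero :: "'i vec" where "vzero = (\<lambda>_. 0)"
definition vadd :: "'i vec \<Rightarrow> 'i vec \<Rightarrow> 'i vec" where "vadd u v = (\<lambda>i. u i + v i)"
definition vsub :: "'i vec \<Rightarrow> 'i vec \<Rightarrow> 'i vec" where "vsub u v = (\<lambda>i. u i - v i)"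
definition scal :: "complex \<Rightarrow> 'i vec \<Rightarrow> 'i vec" where "scal c v = (\<lambda>i. c * v i)"

definition csubspace :: "'i vec set \<Rightarrow> bool" where
  "csubspace U \<longleftrightarrow> vzero \<in> U \<and> (\<forall>u\<in>U. \<forall>v\<in>U. vadd u v \<in> U) \<and> (\<forall>c. \<forall>u\<in>U. scal c u \<in> U)"

definition clinear_on :: "'i vec set \<Rightarrow> ('i vec \<Rightarrow> 'j vec) \<Rightarrow> bool" where
  "clinear_on V f \<longleftrightarrow> (\<forall>u\<in>V. \<forall>v\<in>V. f (vadd u v) = vadd (f u) (f v)) \<and>
                      (\<forall>c. \<forall>u\<in>V. f (scal c u) = scal c (f u))"

text \<open>BI is generated by X, Y, Z; a BI-module is a complex vector space (here a
  subspace of coefficient functions) with the actions of the three generators.\<close>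

datatype gen = GX | GY | GZ

record 'i bimod =
  carrier :: "'i vec set"
  act :: "gen \<Rightarrow> 'i vec \<Rightarrow> 'i vec"

definition bi_hom :: "'i bimod \<Rightarrow> 'j bimod \<Rightarrow> ('i vec \<Rightarrow> 'j vec) \<Rightarrow> bool" where
  "bi_hom M N f \<longleftrightarrow> clinear_on (carrier M) f \<and> f ` carrier M \<subseteq> carrier N \<and>
     (\<forall>g. \<forall>v\<in>carrier M. f (act M g v) = act N g (f v))"

definition bi_iso :: "'i bimod \<Rightarrow> 'j bimod \<Rightarrow> bool" where
  "bi_iso M N \<longleftrightarrow> (\<exists>f. bi_hom M N f \<and> bij_betw f (carrier M) (carrier N))"

definition bi_submodule :: "'i vec set \<Rightarrow> 'i bimod \<Rightarrow> bool" where
  "bi_submodule U M \<longleftrightarrow> U \<subseteq> carrier M \<and> csubspace U \<and> (\<forall>g. \<forall>u\<in>U. act M g u \<in> U)"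

definition bi_restrict :: "'i bimod \<Rightarrow> 'i vec set \<Rightarrow> 'i bimod" where
  "bi_restrict M U = M\<lparr>carrier := U\<rparr>"

text \<open>The quotient module M/U is isomorphic to N: by the first isomorphism theorem,
  expressed as the existence of a surjective module homomorphism M \<rightarrow> N with kernel U.\<close>
definition bi_quot_iso :: "'i bimod \<Rightarrow> 'i vec set \<Rightarrow> 'j bimod \<Rightarrow> bool" where
  "bi_quot_iso M U N \<longleftrightarrow> bi_submodule U M \<and>
     (\<exists>f. bi_hom M N f \<and> f ` carrier M = carrier N \<and> {v \<in> carrier M. f v = vzero} = U)"

definition bi_irreducible :: "'i bimod \<Rightarrow> bool" where
  "bi_irreducible M \<longleftrightarrow> carrier M \<noteq> {vzero} \<and>
     (\<forall>U. bi_submodule U M \<longrightarrow> U = {vzero} \<or> U = carrier M)"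

definition dsum :: "'i bimod \<Rightarrow> 'j bimod \<Rightarrow> ('i + 'j) bimod" where
  "dsum M N = \<lparr>carrier = {w. (w \<circ> Inl) \<in> carrier M \<and> (w \<circ> Inr) \<in> carrier N},
               act = (\<lambda>g w. case_sum (act M g (w \<circ> Inl)) (act N g (w \<circ> Inr)))\<rparr>"

type_synonym aut = "gen \<Rightarrow> complex \<times> gen"

definition twist :: "'i bimod \<Rightarrow> aut \<Rightarrow> 'i bimod" where
  "twist M e = M\<lparr>act := (\<lambda>g v. scal (fst (e g)) (act M (snd (e g)) v))\<rparr>"

definition aut_comp :: "aut \<Rightarrow> aut \<Rightarrow> aut" where
  "aut_comp e s = (\<lambda>g. (fst (s g) * fst (e (snd (s g))), snd (e (snd (s g)))))"

text \<open>the cycle (1 2 3): W_i \<mapsto> W_(\<sigma> i), i.e. X \<mapsto> Y, Y \<mapsto> Z, Z \<mapsto> X\<close>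
definition perm123 :: aut where
  "perm123 g = (case g of GX \<Rightarrow> (1, GY) | GY \<Rightarrow> (1, GZ) | GZ \<Rightarrow> (1, GX))"

definition sign_mm :: aut where
  "sign_mm g = (case g of GX \<Rightarrow> (-1, GX) | GY \<Rightarrow> (-1, GY) | GZ \<Rightarrow> (1, GZ))"

definition Oth :: "complex \<Rightarrow> nat \<Rightarrow> nat \<Rightarrow> complex" where
  "Oth a d i = (-1)^i * (2*a - of_nat d + 2 * of_nat i) / 2"

definition Ophi :: "complex \<Rightarrow> complex \<Rightarrow> complex \<Rightarrow> nat \<Rightarrow> nat \<Rightarrow> complex" where
  "Ophi a b c d i = (if even i
     then of_nat i * (of_nat d + 1 - 2 * of_nat i - 2*a - 2*b - 2*c) / 2
     else (of_nat i - of_nat d - 1) * (of_nat d + 1 - 2 * of_nat i - 2*a - 2*b + 2*c) / 2)"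

definition OX :: "complex \<Rightarrow> nat \<Rightarrow> nat vec \<Rightarrow> nat vec" where
  "OX a d v = (\<lambda>i. if i \<le> d then Oth a d i * v i + (if 1 \<le> i then v (i - 1) else 0) else 0)"

definition OY :: "complex \<Rightarrow> complex \<Rightarrow> complex \<Rightarrow> nat \<Rightarrow> nat vec \<Rightarrow> nat vec" where
  "OY a b c d v = (\<lambda>i. if i \<le> d then Oth b d i * v i + (if i + 1 \<le> d then Ophi a b c d (i+1) * v (i + 1) else 0) else 0)"

definition OZ :: "complex \<Rightarrow> complex \<Rightarrow> complex \<Rightarrow> nat \<Rightarrow> nat vec \<Rightarrow> nat vec" where
  "OZ a b c d v = (\<lambda>i. if i \<le> d then
       OX a d (OY a b c d v) i + OY a b c d (OX a d v) i - (2*a*b - c * (of_nat d + 1)) * v i else 0)"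

definition Omod :: "nat \<Rightarrow> complex \<Rightarrow> complex \<Rightarrow> complex \<Rightarrow> nat bimod" where
  "Omod d a b c = \<lparr>carrier = {v. \<forall>i>d. v i = 0},
     act = (\<lambda>g. case g of GX \<Rightarrow> OX a d | GY \<Rightarrow> OY a b c d | GZ \<Rightarrow> OZ a b c d)\<rparr>"

datatype two = C0 | C1

text \<open>An element of C^2 \<otimes> R[x1,x2,x3] is given by its coefficients: f (s,(a,b,c)) is the
  s-th C^2-component of the coefficient of x1^a x2^b x3^c.\<close>
type_synonym idx = "two \<times> (nat \<times> nat \<times> nat)"

definition ex :: "nat \<Rightarrow> nat \<times> nat \<times> nat \<Rightarrow> nat" where
  "ex i m = (case m of (a,b,c) \<Rightarrow> if i = 1 then a else if i = 2 then b else c)"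

definition incr :: "nat \<Rightarrow> nat \<times> nat \<times> nat \<Rightarrow> nat \<times> nat \<times> nat" where
  "incr i m = (case m of (a,b,c) \<Rightarrow> if i = 1 then (a+1,b,c) else if i = 2 then (a,b+1,c) else (a,b,c+1))"

definition decr :: "nat \<Rightarrow> nat \<times> nat \<times> nat \<Rightarrow> nat \<times> nat \<times> nat" where
  "decr i m = (case m of (a,b,c) \<Rightarrow> if i = 1 then (a-1,b,c) else if i = 2 then (a,b-1,c) else (a,b,c-1))"

definition Pn :: "nat \<Rightarrow> idx vec set" where
  "Pn n = {f. \<forall>s a b c. a + b + c \<noteq> n \<longrightarrow> f (s,(a,b,c)) = 0}"

text \<open>R_i : x_i \<mapsto> -x_i\<close>
definition Rop :: "nat \<Rightarrow> idx vec \<Rightarrow> idx vec" where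
  "Rop i f = (\<lambda>(s,m). (-1)^(ex i m) * f (s,m))"

definition mulx :: "nat \<Rightarrow> idx vec \<Rightarrow> idx vec" where
  "mulx i f = (\<lambda>(s,m). if ex i m = 0 then 0 else f (s, decr i m))"

text \<open>Dunkl operator T_i f = df/dx_i + k_i (f - R_i f)/x_i, on coefficients:
  T_i x^a = (a_i + k_i (1 - (-1)^a_i)) x^(a - e_i).\<close>
definition Tdunkl :: "(nat \<Rightarrow> real) \<Rightarrow> nat \<Rightarrow> idx vec \<Rightarrow> idx vec" where
  "Tdunkl k i f = (\<lambda>(s,m). (of_nat (ex i m + 1) + complex_of_real (k i) * (1 - (-1)^(ex i m + 1)))
                            * f (s, incr i m))"

definition pauli :: "nat \<Rightarrow> idx vec \<Rightarrow> idx vec" where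
  "pauli i f = (\<lambda>(s,m).
     if i = 1 then (case s of C0 \<Rightarrow> f (C1,m) | C1 \<Rightarrow> f (C0,m))
     else if i = 2 then (case s of C0 \<Rightarrow> - \<i> * f (C1,m) | C1 \<Rightarrow> \<i> * f (C0,m))
     else (case s of C0 \<Rightarrow> f (C0,m) | C1 \<Rightarrow> - f (C1,m)))"

definition Dirac :: "(nat \<Rightarrow> real) \<Rightarrow> idx vec \<Rightarrow> idx vec" where
  "Dirac k f = vadd (pauli 1 (Tdunkl k 1 f)) (vadd (pauli 2 (Tdunkl k 2 f)) (pauli 3 (Tdunkl k 3 f)))"

definition Mn :: "(nat \<Rightarrow> real) \<Rightarrow> nat \<Rightarrow> idx vec set" where
  "Mn k n = {f \<in> Pn n. Dirac k f = vzero}"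

definition ang :: "(nat \<Rightarrow> real) \<Rightarrow> nat \<Rightarrow> nat \<Rightarrow> nat \<Rightarrow> idx vec \<Rightarrow> idx vec" where
  "ang k i p q f = (let g = Rop p (Rop q f) in
     vadd (vadd (scal \<i> (pauli i (vsub (mulx q (Tdunkl k p g)) (mulx p (Tdunkl k q g)))))
                (scal (1/2) g))
          (vadd (scal (complex_of_real (k p)) (Rop q f)) (scal (complex_of_real (k q)) (Rop p f))))"

definition Mmod :: "(nat \<Rightarrow> real) \<Rightarrow> nat \<Rightarrow> idx bimod" where
  "Mmod k n = \<lparr>carrier = Mn k n,
     act = (\<lambda>g. case g of GX \<Rightarrow> ang k 1 2 3 | GY \<Rightarrow> ang k 2 3 1 | GZ \<Rightarrow> ang k 3 1 2)\<rparr>"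

definition tval :: "real \<Rightarrow> enat" where
  "tval x = (if \<exists>m::nat. odd m \<and> 2 * x = - real m then enat (nat \<lfloor>-2 * x\<rfloor>) else \<infinity>)"

definition Mnx :: "(nat \<Rightarrow> real) \<Rightarrow> nat \<Rightarrow> nat \<Rightarrow> idx vec set" where
  "Mnx k n i = {f \<in> Mn k n. \<forall>s m. enat (ex i m) < tval (k i) \<longrightarrow> f (s,m) = 0}"

end

theory Submission
  imports Defs
begin

text \<open>
  An element of the kernel of the Dirac operator is determined by its restriction to $x_2 = 0$, which
  may be prescribed arbitrarily because $T_2$ has no zero coefficient in degrees up to $n$
  (Cauchy--Kovalevskaya). On the restrictions all three generators involve only $x_1$, $x_3$ and
  $e_2$, so they preserve the two eigenspaces of $e_2$. On each of them, in the monomial basis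
  $x_1^i x_3^{n-i}$, $Z$ is lower and $X$ is upper bidiagonal and $Y$ is tridiagonal; after rescaling
  the basis this is a twisted $O_d$. Since $T_1$ kills $x_1^{t_1}$, the exponents $i \<ge> t_1$ span a
  submodule and the exponents $i < t_1$ carry the quotient.

  For irreducibility and the last two isomorphisms, diagonalise the upper bidiagonal $Y$ on
  $O_d(a,b,c)$. The relation $\{Y,Z\} - X = \lambda$ forces $X$ to be tridiagonal in the eigenbasis, with
  superdiagonal times subdiagonal entries $\delta_j$ that factor into linear terms. If they are all nonzero
  the module is irreducible, and it is determined by the eigenvalues, the diagonal and the $\delta_j$.
\<close>

section \<open>Modules given by bidiagonal and tridiagonal matrices\<close>

text \<open>Only e_2 survives on the slice x_2 = 0 for the following reason. T_2 is the one
  derivative that restriction does not see, and the Dirac equation replaces e_2 T_2 by -(e_1 T_1 +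
  e_3 T_3); products such as e_1 e_2 e_1 = -e_2 and e_1 e_2 e_3 = i then leave scalars and multiples
  of e_2. The bound n < t_3 makes the subdiagonal of Z nonzero, so that it can be scaled to a
  constant. The two eigenspaces of e_2 lead to the same parameters, so every module occurs twice.
  The sign of W_1 is (-1)^lo, where lo is the lowest x_1-exponent in use: lo = t_1 is odd for the
  submodule, while lo = 0 for the quotient. The obstacle in the last two isomorphisms is that the
  bidiagonal bases of the two sides are unrelated. Both sides are therefore written in an eigenbasis
  of X. On the twisted side X is Y or -Y of O_d, which is diagonalised directly; on the untwisted
  side an eigenbasis of Y is the wrong one, so the target is first presented as a twist of another
  O_d that exchanges X and Y up to sign.\<close>

lemmas vec_defs = vzero_def vadd_def vsub_def scal_def

section \<open>Homomorphisms, isomorphisms and transport of irreducibility\<close>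

lemma bi_hom_comp:
  assumes "bi_hom L M f" and "bi_hom M N g"
  shows "bi_hom L N (g \<circ> f)"
  using assms unfolding bi_hom_def clinear_on_def by (auto simp: image_subset_iff)

lemma bi_iso_trans:
  assumes "bi_iso L M" and "bi_iso M N"
  shows "bi_iso L N"
  using assms unfolding bi_iso_def by (meson bi_hom_comp bij_betw_trans)

text \<open>A record of type \<open>bimod\<close> need not have a stable subspace as carrier;
  inverse maps and preimages of submodules require it.\<close>

definition bi_closed :: "'i bimod \<Rightarrow> bool" where
  "bi_closed M \<longleftrightarrow> bi_submodule (carrier M) M"

lemma bi_iso_sym:
  assumes M: "bi_closed M" and "bi_iso M N"
  shows "bi_iso N M"
proof -
  obtain f where f: "bi_hom M N f" and b: "bij_betw f (carrier M) (carrier N)"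
    using assms(2) unfolding bi_iso_def by blast
  let ?g = "the_inv_into (carrier M) f"
  have gb: "bij_betw ?g (carrier N) (carrier M)" using b by (rule bij_betw_the_inv_into)
  have inj: "inj_on f (carrier M)" and im: "f ` carrier M = carrier N"
    using b unfolding bij_betw_def by auto
  have gin: "?g y \<in> carrier M" and fg: "f (?g y) = y" if "y \<in> carrier N" for y
    using that gb inj im by (auto simp: bij_betw_def f_the_inv_into_f)
  have gI: "?g y = x" if "x \<in> carrier M" "f x = y" for x y
    using that inj by (auto simp: the_inv_into_f_f)
  have Mc: "\<And>u v. u \<in> carrier M \<Longrightarrow> v \<in> carrier M \<Longrightarrow> vadd u v \<in> carrier M"
    "\<And>c u. u \<in> carrier M \<Longrightarrow> scal c u \<in> carrier M"
    "\<And>g u. u \<in> carrier M \<Longrightarrow> act M g u \<in> carrier M"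
    using M unfolding bi_closed_def bi_submodule_def csubspace_def by auto
  have "bi_hom N M ?g"
    unfolding bi_hom_def clinear_on_def
  proof (intro conjI ballI allI)
    fix u v assume "u \<in> carrier N" "v \<in> carrier N"
    then show "?g (vadd u v) = vadd (?g u) (?g v)"
      using f by (intro gI) (auto simp: Mc gin fg bi_hom_def clinear_on_def)
  next
    fix c u assume "u \<in> carrier N"
    then show "?g (scal c u) = scal c (?g u)"
      using f by (intro gI) (auto simp: Mc gin fg bi_hom_def clinear_on_def)
  next
    show "?g ` carrier N \<subseteq> carrier M" using gin by auto
  next
    fix h v assume "v \<in> carrier N"
    then show "?g (act N h v) = act M h (?g v)"
      using f by (intro gI) (auto simp: Mc gin fg bi_hom_def)
  qed
  then show ?thesis using gb unfolding bi_iso_def by blast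
qed

lemma clinear_on_vzero:
  assumes "clinear_on V f" and "vzero \<in> V"
  shows "f vzero = vzero"
proof -
  have "f (scal 0 vzero) = scal 0 (f vzero)" using assms unfolding clinear_on_def by blast
  then show ?thesis by (simp add: vec_defs)
qed

lemma bi_irreducible_iso:
  assumes M: "bi_closed M" and "bi_iso M N" and irr: "bi_irreducible M"
  shows "bi_irreducible N"
proof -
  obtain f where f: "bi_hom M N f" and b: "bij_betw f (carrier M) (carrier N)"
    using assms(2) unfolding bi_iso_def by blast
  have inj: "inj_on f (carrier M)" and im: "f ` carrier M = carrier N"
    using b unfolding bij_betw_def by auto
  have z: "vzero \<in> carrier M"
    using M unfolding bi_closed_def bi_submodule_def csubspace_def by auto
  have fz: "f vzero = vzero"
    using f z unfolding bi_hom_def by (blast intro: clinear_on_vzero)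
  have "carrier N \<noteq> {vzero}"
  proof
    assume N: "carrier N = {vzero}"
    then have "carrier M \<subseteq> {vzero}"
      using im fz inj z by (metis imageI inj_onD singletonD singletonI subsetI)
    then show False using irr z unfolding bi_irreducible_def by blast
  qed
  moreover have "U = {vzero} \<or> U = carrier N" if U: "bi_submodule U N" for U
  proof -
    let ?W = "{v \<in> carrier M. f v \<in> U}"
    have fW: "f ` ?W = U" using U im unfolding bi_submodule_def by auto
    have "bi_submodule ?W M"
      using U M f z fz unfolding bi_closed_def bi_submodule_def csubspace_def bi_hom_def clinear_on_def
      by auto
    then have "?W = {vzero} \<or> ?W = carrier M" using irr unfolding bi_irreducible_def by blast
    then show ?thesis
    proof
      assume "?W = {vzero}"
      then have "U = f ` {vzero}" using fW by simp
      then show ?thesis using fz by simp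
    next
      assume "?W = carrier M"
      then show ?thesis using fW im by simp
    qed
  qed
  ultimately show ?thesis unfolding bi_irreducible_def by blast
qed

section \<open>Tridiagonal modules on finite sequences\<close>

definition finvec :: "nat \<Rightarrow> nat vec set" where
  "finvec d = {v. \<forall>i>d. v i = 0}"

lemma csubspace_finvec: "csubspace (finvec d)"
  by (auto simp: csubspace_def finvec_def vec_defs)

text \<open>Both \<open>p i\<close> and \<open>r i\<close> belong to the edge between i - 1 and i,
  below and above the diagonal respectively. With this indexing the products
  \<open>p i * r i\<close> are the quantities that a diagonal change of basis preserves.\<close>

definition tri :: "nat \<Rightarrow> (nat \<Rightarrow> complex) \<Rightarrow> (nat \<Rightarrow> complex) \<Rightarrow> (nat \<Rightarrow> complex) \<Rightarrow> nat vec \<Rightarrow> nat vec" where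
  "tri d p q r v = (\<lambda>i. if i \<le> d
     then (if i = 0 then 0 else p i * v (i - 1)) + q i * v i + (if i < d then r (i + 1) * v (i + 1) else 0)
     else 0)"

lemma tri_finvec: "tri d p q r v \<in> finvec d"
  by (simp add: tri_def finvec_def)

lemma tri_linear:
  "tri d p q r (vadd u v) = vadd (tri d p q r u) (tri d p q r v)"
  "tri d p q r (vsub u v) = vsub (tri d p q r u) (tri d p q r v)"
  "tri d p q r (scal c u) = scal c (tri d p q r u)"
  by (auto simp: tri_def vec_defs algebra_simps fun_eq_iff)

definition anticomm :: "('i vec \<Rightarrow> 'i vec) \<Rightarrow> ('i vec \<Rightarrow> 'i vec) \<Rightarrow> complex \<Rightarrow> 'i vec \<Rightarrow> 'i vec" where
  "anticomm A B c v = vsub (vadd (A (B v)) (B (A v))) (scal c v)"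

text \<open>The normal form in which modules are compared: X in an eigenbasis, Y tridiagonal, and Z
  recovered from the scalar value c of {X,Y} - Z.\<close>

definition Tmod :: "nat \<Rightarrow> (nat \<Rightarrow> complex) \<Rightarrow> (nat \<Rightarrow> complex) \<Rightarrow> (nat \<Rightarrow> complex) \<Rightarrow> (nat \<Rightarrow> complex)
    \<Rightarrow> complex \<Rightarrow> nat bimod" where
  "Tmod d \<theta> \<alpha> p r c = \<lparr>carrier = finvec d, act = (\<lambda>g. case g of
      GX \<Rightarrow> tri d (\<lambda>_. 0) \<theta> (\<lambda>_. 0) | GY \<Rightarrow> tri d p \<alpha> r
    | GZ \<Rightarrow> anticomm (tri d (\<lambda>_. 0) \<theta> (\<lambda>_. 0)) (tri d p \<alpha> r) c)\<rparr>"

lemma bi_closed_Tmod: "bi_closed (Tmod d \<theta> \<alpha> p r c)"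
proof -
  have *: "act (Tmod d \<theta> \<alpha> p r c) g v \<in> finvec d" if "v \<in> finvec d" for g v
  proof (cases g)
    case GZ
    then show ?thesis using that by (auto simp: Tmod_def anticomm_def finvec_def tri_def vec_defs)
  qed (auto simp: Tmod_def tri_finvec)
  then show ?thesis
    unfolding bi_closed_def bi_submodule_def using csubspace_finvec[of d] by (auto simp: Tmod_def)
qed

lemma bi_hom_of_XY:
  assumes lin: "clinear_on (carrier M) f" and im: "f ` carrier M \<subseteq> carrier N"
    and cl: "bi_closed M"
    and X: "\<And>v. v \<in> carrier M \<Longrightarrow> f (act M GX v) = act N GX (f v)"
    and Y: "\<And>v. v \<in> carrier M \<Longrightarrow> f (act M GY v) = act N GY (f v)"
    and ZM: "\<And>v. v \<in> carrier M \<Longrightarrow> act M GZ v = anticomm (act M GX) (act M GY) c v"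
    and ZN: "\<And>v. v \<in> carrier N \<Longrightarrow> act N GZ v = anticomm (act N GX) (act N GY) c v"
  shows "bi_hom M N f"
proof -
  have Mc: "\<And>u v. u \<in> carrier M \<Longrightarrow> v \<in> carrier M \<Longrightarrow> vadd u v \<in> carrier M"
    "\<And>c u. u \<in> carrier M \<Longrightarrow> scal c u \<in> carrier M"
    "\<And>g u. u \<in> carrier M \<Longrightarrow> act M g u \<in> carrier M"
    using cl unfolding bi_closed_def bi_submodule_def csubspace_def by auto
  have fl: "\<And>u v. u \<in> carrier M \<Longrightarrow> v \<in> carrier M \<Longrightarrow> f (vadd u v) = vadd (f u) (f v)"
    "\<And>c u. u \<in> carrier M \<Longrightarrow> f (scal c u) = scal c (f u)"
    using lin unfolding clinear_on_def by auto
  have sub: "vsub u v = vadd u (scal (-1) v)" for u v :: "'c vec"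
    by (simp add: vec_defs)
  have sub': "vsub u v = vadd u (scal (-1) v)" for u v :: "'a vec"
    by (simp add: vec_defs)
  have Z: "f (act M GZ v) = act N GZ (f v)" if v: "v \<in> carrier M" for v
  proof -
    have fv: "f v \<in> carrier N" using im v by auto
    show ?thesis
      by (simp add: ZM[OF v] ZN[OF fv] anticomm_def sub sub' fl Mc v X Y)
  qed
  show ?thesis unfolding bi_hom_def
  proof (intro conjI allI ballI)
    fix g v assume "v \<in> carrier M"
    then show "f (act M g v) = act N g (f v)" by (cases g) (auto simp: X Y Z)
  qed (use lin im in auto)
qed

definition unitv :: "nat \<Rightarrow> nat vec" where
  "unitv j = (\<lambda>i. if i = j then 1 else 0)"

lemma tri_diag: "tri d (\<lambda>_. 0) \<theta> (\<lambda>_. 0) v = (\<lambda>i. if i \<le> d then \<theta> i * v i else 0)"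
  by (auto simp: tri_def fun_eq_iff)

text \<open>Distinct eigenvalues of X isolate the basis vectors occurring in an element of a
  submodule, and the nonzero entries of Y lead from each basis vector to its neighbours.\<close>

lemma bi_irreducible_Tmod:
  assumes \<theta>: "inj_on \<theta> {..d}"
    and p: "\<And>j. 1 \<le> j \<Longrightarrow> j \<le> d \<Longrightarrow> p j \<noteq> 0" and r: "\<And>j. 1 \<le> j \<Longrightarrow> j \<le> d \<Longrightarrow> r j \<noteq> 0"
  shows "bi_irreducible (Tmod d \<theta> \<alpha> p r c)"
proof -
  let ?T = "Tmod d \<theta> \<alpha> p r c"
  have carr: "carrier ?T = finvec d" by (simp add: Tmod_def)
  have "unitv 0 \<in> finvec d" "unitv 0 \<noteq> vzero"
    by (auto simp: unitv_def finvec_def vzero_def fun_eq_iff)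
  then have "carrier ?T \<noteq> {vzero}" unfolding carr by auto
  moreover have "U = {vzero} \<or> U = carrier ?T" if U: "bi_submodule U ?T" for U
  proof -
    have sub: "U \<subseteq> finvec d" and add: "\<And>u v. u \<in> U \<Longrightarrow> v \<in> U \<Longrightarrow> vadd u v \<in> U"
      and sc: "\<And>c u. u \<in> U \<Longrightarrow> scal c u \<in> U" and z: "vzero \<in> U"
      and ac: "\<And>g u. u \<in> U \<Longrightarrow> act ?T g u \<in> U"
      using U carr unfolding bi_submodule_def csubspace_def by auto
    have unit: "unitv j \<in> U" if "w \<in> U" "j \<le> d" "w j \<noteq> 0" for w j
      using that
    proof (induction "card {i. i \<le> d \<and> w i \<noteq> 0}" arbitrary: w rule: less_induct)
      case less
      show ?case
      proof (cases "\<exists>h\<le>d. h \<noteq> j \<and> w h \<noteq> 0")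
        case True
        then obtain h where h: "h \<le> d" "h \<noteq> j" "w h \<noteq> 0" by blast
        \<comment> \<open>Applying X - theta_h removes h from the support and multiplies every other
          coordinate by a nonzero factor, so coordinate j survives.\<close>
        let ?w = "vadd (act ?T GX w) (scal (- \<theta> h) w)"
        have w': "?w i = (\<theta> i - \<theta> h) * w i" if "i \<le> d" for i
          using that by (simp add: Tmod_def tri_diag vec_defs algebra_simps)
        have "?w h = 0" using w'[OF h(1)] by simp
        then have "h \<notin> {i. i \<le> d \<and> ?w i \<noteq> 0}" "h \<in> {i. i \<le> d \<and> w i \<noteq> 0}" using h by auto
        moreover have "{i. i \<le> d \<and> ?w i \<noteq> 0} \<subseteq> {i. i \<le> d \<and> w i \<noteq> 0}" using w' by auto
        ultimately have "{i. i \<le> d \<and> ?w i \<noteq> 0} \<subset> {i. i \<le> d \<and> w i \<noteq> 0}" by blast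
        then have "card {i. i \<le> d \<and> ?w i \<noteq> 0} < card {i. i \<le> d \<and> w i \<noteq> 0}"
          by (intro psubset_card_mono) auto
        moreover have "?w \<in> U" using less.prems ac sc add by blast
        moreover have "?w j \<noteq> 0"
          using w'[OF less.prems(2)] less.prems h \<theta> by (auto dest: inj_onD)
        ultimately show ?thesis using less.hyps less.prems(2) by blast
      next
        case False
        have "w i = 0" if "i \<noteq> j" for i
        proof (cases "i \<le> d")
          case False
          then show ?thesis using less.prems(1) sub by (auto simp: finvec_def)
        qed (use False that in blast)
        then have "unitv j = scal (1 / w j) w"
          using less.prems(3) by (auto simp: unitv_def vec_defs fun_eq_iff)
        then show ?thesis using sc less.prems by metis
      qed
    qed
    \<comment> \<open>Y also produces components at j - 1 and j; \<open>unit\<close> discards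
      them.\<close>
    have up: "unitv (Suc j) \<in> U" if "unitv j \<in> U" "Suc j \<le> d" for j
      by (rule unit[OF ac[OF that(1), of GY]])
        (use that p[of "Suc j"] in \<open>auto simp: Tmod_def tri_def unitv_def\<close>)
    have down: "unitv j \<in> U" if "unitv (Suc j) \<in> U" "Suc j \<le> d" for j
      by (rule unit[OF ac[OF that(1), of GY]])
        (use that r[of "Suc j"] in \<open>auto simp: Tmod_def tri_def unitv_def\<close>)
    show ?thesis
    proof (cases "U = {vzero}")
      case False
      then obtain w where w: "w \<in> U" "w \<noteq> vzero" using z by auto
      then obtain j where "w j \<noteq> 0" by (auto simp: vzero_def fun_eq_iff)
      moreover have "j \<le> d"
        using w(1) sub \<open>w j \<noteq> 0\<close> unfolding finvec_def by (metis (mono_tags) mem_Collect_eq not_le subsetD)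
      ultimately have uj: "unitv j \<in> U" using unit w(1) by blast
      have u0: "unitv 0 \<in> U" using uj \<open>j \<le> d\<close> by (induction j) (auto dest: down)
      have ui: "unitv i \<in> U" if "i \<le> d" for i using that by (induction i) (auto simp: u0 up)
      have "v \<in> U" if v: "v \<in> finvec d" for v
      proof -
        have "(\<lambda>i. if i < m then v i else 0) \<in> U" if "m \<le> Suc d" for m
          using that
        proof (induction m)
          case 0 then show ?case using z by (simp add: vzero_def)
        next
          case (Suc m)
          have "(\<lambda>i. if i < Suc m then v i else 0)
              = vadd (\<lambda>i. if i < m then v i else 0) (scal (v m) (unitv m))"
            by (auto simp: vec_defs unitv_def fun_eq_iff less_Suc_eq)
          then show ?case using Suc ui add sc by simp
        qed
        moreover have "(\<lambda>i. if i < Suc d then v i else 0) = v"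
          using v by (auto simp: finvec_def)
        ultimately show ?thesis by (metis order_refl)
      qed
      then show ?thesis using sub carr by auto
    qed simp
  qed
  ultimately show ?thesis unfolding bi_irreducible_def by blast
qed

text \<open>The diagonal matrix with entries s_j, where s_j / s_(j-1) = p'_j / p_j, carries p to p';
  equality of the products then carries r to r'.\<close>

lemma bi_iso_Tmod_rescale:
  assumes pr: "\<And>j. 1 \<le> j \<Longrightarrow> j \<le> d \<Longrightarrow> p j * r j = p' j * r' j"
    and nz: "\<And>j. 1 \<le> j \<Longrightarrow> j \<le> d \<Longrightarrow> p' j \<noteq> 0" "\<And>j. 1 \<le> j \<Longrightarrow> j \<le> d \<Longrightarrow> p j \<noteq> 0"
    and eq: "\<And>j. j \<le> d \<Longrightarrow> \<theta> j = \<theta>' j" "\<And>j. j \<le> d \<Longrightarrow> \<alpha> j = \<alpha>' j"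
  shows "bi_iso (Tmod d \<theta> \<alpha> p r c) (Tmod d \<theta>' \<alpha>' p' r' c)"
proof -
  let ?M = "Tmod d \<theta> \<alpha> p r c" and ?N = "Tmod d \<theta>' \<alpha>' p' r' c"
  define s where "s j = (\<Prod>h\<in>{1..j}. p' h / p h)" for j
  have snz: "s j \<noteq> 0" if "j \<le> d" for j using that nz by (auto simp: s_def)
  have sS: "s (Suc j) * p (Suc j) = s j * p' (Suc j)" if "Suc j \<le> d" for j
    using that nz by (simp add: s_def)
  have sr: "s j * r (Suc j) = s (Suc j) * r' (Suc j)" if "Suc j \<le> d" for j
  proof -
    have "s j * r (Suc j) * (p (Suc j) * p' (Suc j)) = s (Suc j) * r' (Suc j) * (p (Suc j) * p' (Suc j))"
      using sS[OF that] pr[of "Suc j"] that by simp algebra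
    then show ?thesis using that nz[of "Suc j"] by simp
  qed
  let ?f = "\<lambda>v i. s i * v i"
  have c: "carrier ?M = finvec d" "carrier ?N = finvec d" by (auto simp: Tmod_def)
  have hom: "bi_hom ?M ?N ?f"
  proof (rule bi_hom_of_XY[where c = c])
    fix v assume "v \<in> carrier ?M"
    show "?f (act ?M GX v) = act ?N GX (?f v)"
      by (auto simp: Tmod_def tri_diag fun_eq_iff eq)
    show "?f (act ?M GY v) = act ?N GY (?f v)"
    proof
      fix i show "?f (act ?M GY v) i = act ?N GY (?f v) i"
        using sS[of "i - 1"] sr[of i] by (cases i) (auto simp: Tmod_def tri_def eq algebra_simps)
    qed
  qed (auto simp: c bi_closed_Tmod clinear_on_def vec_defs algebra_simps finvec_def, auto simp: Tmod_def)
  have "bij_betw ?f (finvec d) (finvec d)"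
    by (rule bij_betw_byWitness[where f' = "\<lambda>v i. if i \<le> d then v i / s i else 0"])
      (auto simp: finvec_def fun_eq_iff snz not_le)
  then show ?thesis unfolding bi_iso_def c using hom by blast
qed

text \<open>Reversal sends the edge between i - 1 and i to the edge between d - i and d + 1 - i,
  hence the shift by one in the off-diagonal entries and the exchange of p and r.\<close>

lemma bi_iso_Tmod_reverse:
  "bi_iso (Tmod d \<theta> \<alpha> p r c)
     (Tmod d (\<lambda>i. \<theta> (d - i)) (\<lambda>i. \<alpha> (d - i)) (\<lambda>i. r (d + 1 - i)) (\<lambda>i. p (d + 1 - i)) c)"
  (is "bi_iso ?M ?N")
proof -
  let ?f = "\<lambda>v i. if i \<le> d then v (d - i) else 0"
  have c: "carrier ?M = finvec d" "carrier ?N = finvec d" by (auto simp: Tmod_def)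
  have hom: "bi_hom ?M ?N ?f"
  proof (rule bi_hom_of_XY[where c = c])
    fix v assume "v \<in> carrier ?M"
    show "?f (act ?M GX v) = act ?N GX (?f v)"
      by (auto simp: Tmod_def tri_diag fun_eq_iff)
    show "?f (act ?M GY v) = act ?N GY (?f v)"
    proof
      fix i show "?f (act ?M GY v) i = act ?N GY (?f v) i"
      proof (cases i)
        case 0 then show ?thesis by (auto simp: Tmod_def tri_def)
      next
        case (Suc i')
        have "Suc (d - Suc i') = d - i'" if "Suc i' \<le> d" using that by simp
        then show ?thesis using Suc by (auto simp: Tmod_def tri_def Suc_diff_Suc)
      qed
    qed
  qed (auto simp: c bi_closed_Tmod clinear_on_def vec_defs algebra_simps finvec_def, auto simp: Tmod_def finvec_def)
  have "bij_betw ?f (finvec d) (finvec d)"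
    by (rule bij_betw_byWitness[where f' = ?f]) (auto simp: finvec_def)
  then show ?thesis unfolding bi_iso_def c using hom by blast
qed

section \<open>The modules $O_d(a,b,c)$ in an eigenbasis of $Y$\<close>

lemma Ophi_0: "Ophi a b c d 0 = 0"
  by (simp add: Ophi_def)

text \<open>For even d the index d + 1 is odd, so the factor i - d - 1 applies. This lets identities
  involving the neighbour i + 1 hold at the last index too.\<close>

lemma Ophi_Suc: "even d \<Longrightarrow> Ophi a b c d (Suc d) = 0"
  by (simp add: Ophi_def)

lemma OX_tri: "OX a d = tri d (\<lambda>_. 1) (Oth a d) (\<lambda>_. 0)"
  by (auto simp: OX_def tri_def fun_eq_iff)

lemma OY_tri: "OY a b c d = tri d (\<lambda>_. 0) (Oth b d) (Ophi a b c d)"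
  by (auto simp: OY_def tri_def fun_eq_iff)

text \<open>The diagonal of Z on O_d(a,b,c).\<close>

definition Ozeta :: "complex \<Rightarrow> nat \<Rightarrow> nat \<Rightarrow> complex" where
  "Ozeta c d i = - 1/2 + (-1)^i * (c + (of_nat d + 1) / 2)"

lemma Ozeta_eq:
  "2 * Oth a d i * Oth b d i + Ophi a b c d i + Ophi a b c d (Suc i) - (2 * a * b - c * (of_nat d + 1))
   = Ozeta c d i"
  by (cases "even i") (simp_all add: Oth_def Ophi_def Ozeta_def field_simps)

lemma Oth_Suc: "Oth b d (Suc i) = - Oth b d i - (-1)^i"
  by (simp add: Oth_def field_simps)

text \<open>The off-diagonal entries of {X,Y} are those of X and Y times sums of neighbouring
  diagonal entries of the other operator, and every such sum is a sign by
  \<open>Oth_Suc\<close>.\<close>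

lemma OZ_tri:
  assumes "even d"
  shows "OZ a b c d v = tri d (\<lambda>i. (-1)^i) (Ozeta c d) (\<lambda>i. (-1)^i * Ophi a b c d i) v"
proof
  fix i
  have dg: "Ozeta c d i * v i = (2 * Oth a d i * Oth b d i + Ophi a b c d i + Ophi a b c d (Suc i)
     - (2 * a * b - c * (of_nat d + 1))) * v i"
    by (simp only: Ozeta_eq)
  show "OZ a b c d v i = tri d (\<lambda>i. (-1)^i) (Ozeta c d) (\<lambda>i. (-1)^i * Ophi a b c d i) v i"
  proof (cases "i = d")
    case True
    then have d: "d = i" and p: "Ophi a b c i (Suc i) = 0" using Ophi_Suc[OF assms] by auto
    show ?thesis using dg p unfolding d
      by (cases i) (simp_all add: OZ_def OX_tri OY_tri tri_def Ophi_0 Oth_Suc algebra_simps)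
  next
    case False
    then show ?thesis using dg
      by (cases i) (auto simp: OZ_def OX_tri OY_tri tri_def Ophi_0 Oth_Suc algebra_simps)
  qed
qed

lemma Ozeta_Suc: "Ozeta c d (Suc i) = - Ozeta c d i - 1"
  by (simp add: Ozeta_def)

lemma anticomm_YZ_diag:
  "2 * Oth b d i * Ozeta c d i + (-1)^i * Ophi a b c d i - (-1)^i * Ophi a b c d (Suc i)
     - (2 * b * c - a * (of_nat d + 1)) = Oth a d i"
  by (cases "even i") (simp_all add: Oth_def Ophi_def Ozeta_def field_simps)

text \<open>The relation of BI that the definition of O_d does not build in. On the first
  superdiagonal the neighbour sums of Y and Z contribute opposite amounts, on the second the
  alternating signs of Z cancel, and on the subdiagonal two equal signs multiply to 1.\<close>

lemma anticomm_YZ: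
  assumes "even d" and "v \<in> finvec d"
  shows "anticomm (OY a b c d) (OZ a b c d) (2 * b * c - a * (of_nat d + 1)) v i = OX a d v i"
proof (cases "i \<le> d")
  case False
  then show ?thesis using assms(2)
    by (simp add: anticomm_def OX_tri OY_tri OZ_tri[OF assms(1)] tri_def vec_defs finvec_def)
next
  case True
  have dg: "Oth a d i * v i = (2 * Oth b d i * Ozeta c d i + (-1)^i * Ophi a b c d i - (-1)^i * Ophi a b c d (Suc i)
     - (2 * b * c - a * (of_nat d + 1))) * v i"
    by (simp only: anticomm_YZ_diag)
  have sq: "(-1)^j * ((-1)^j * x) = x" for j and x :: complex
    by (simp add: mult.assoc[symmetric] power_mult_distrib[symmetric])
  consider "i = d" | "Suc i = d" | "Suc (Suc i) \<le> d" using True by linarith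
  then show ?thesis
  proof cases
    case 1
    then have d: "d = i" and p: "Ophi a b c i (Suc i) = 0" and e: "even i" using Ophi_Suc assms by auto
    show ?thesis using dg p e unfolding d
      by (cases i) (simp_all add: anticomm_def OX_tri OY_tri OZ_tri tri_def vec_defs
        Ophi_0 Oth_Suc algebra_simps sq)
  next
    case 2
    then have d: "d = Suc i" and e: "even (Suc i)" using assms(1) by auto
    show ?thesis using dg e unfolding d
      by (cases i) (auto simp add: anticomm_def OX_tri OY_tri OZ_tri tri_def vec_defs
        Ophi_0 Oth_Suc Ozeta_Suc algebra_simps sq)
  next
    case 3
    then show ?thesis using dg
      by (cases i) (auto simp add: anticomm_def OX_tri OY_tri OZ_tri[OF assms(1)] tri_def vec_defs
        Ophi_0 Oth_Suc Ozeta_Suc algebra_simps sq)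
  qed
qed

text \<open>The condition says $\theta_i \<noteq> \theta_j$ for $i \<noteq> j$ with $i + j < 2d$, where $\theta_j$ are the diagonal entries of $Y$.
  Eigenvalues whose indices have the same parity are always distinct.\<close>
definition nondeg :: "complex \<Rightarrow> nat \<Rightarrow> bool" where
  "nondeg b d \<longleftrightarrow> (\<forall>m. odd m \<longrightarrow> m < 2 * d \<longrightarrow> 2 * b - of_nat d + of_nat m \<noteq> 0)"

lemma Oth_neq:
  assumes "nondeg b d" and "i \<noteq> j" and "i + j < 2 * d"
  shows "Oth b d i \<noteq> Oth b d j"
proof
  assume eq: "Oth b d i = Oth b d j"
  show False
  proof (cases "even (i + j)")
    case True
    then have "(-1::complex)^i = (-1)^j" by (auto simp: uminus_power_if)
    then have "complex_of_nat i = of_nat j" using eq by (auto simp: Oth_def)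
    then show False using assms(2) by simp
  next
    case False
    then have m: "(-1::complex)^j = - ((-1)^i)" by (auto simp: uminus_power_if)
    have cancel: "x = - y" if "s * x = - (s * y)" "s \<noteq> 0" for s x y :: complex
      using that by (metis mult_left_cancel mult_minus_right)
    have "(-1)^i * (2 * b - of_nat d + 2 * of_nat i) = - ((-1)^i * (2 * b - of_nat d + 2 * of_nat j))"
      using eq m by (simp add: Oth_def)
    then have "2 * b - of_nat d + 2 * of_nat i = - (2 * b - of_nat d + 2 * of_nat j)"
      by (rule cancel) simp
    then have "2 * (2 * b - of_nat d + of_nat (i + j)) = 0"
      by (simp add: algebra_simps)
    then have "2 * b - of_nat d + of_nat (i + j) = 0"
      by (metis mult_eq_0_iff zero_neq_numeral)
    then show False using assms False unfolding nondeg_def by blast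
  qed
qed

text \<open>With $\theta_j$ the eigenvalues of $Y$, this is $\varphi_j / (\theta_j - \theta_{j-1})$: the coefficient of
  the basis vector $v_{j-1}$ in the $j$-th eigenvector of $Y$.\<close>
definition Oomega :: "complex \<Rightarrow> complex \<Rightarrow> complex \<Rightarrow> nat \<Rightarrow> nat \<Rightarrow> complex" where
  "Oomega a b c d j = (-1)^j * Ophi a b c d j / (2 * b - of_nat d + 2 * of_nat j - 1)"

text \<open>With y_j the eigenvector of Y whose v_j-coefficient is 1, the target is X y_j = y_(j+1)
  + alpha_j y_j + delta_j y_(j-1). Comparing coefficients of v_j gives this value of
  alpha_j.\<close>

definition Oalpha :: "complex \<Rightarrow> complex \<Rightarrow> complex \<Rightarrow> nat \<Rightarrow> nat \<Rightarrow> complex" where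
  "Oalpha a b c d j = Oth a d j + Oomega a b c d j - Oomega a b c d (Suc j)"

text \<open>The linear factors of delta_j that do not already occur in phi_j.\<close>

definition Opsi :: "complex \<Rightarrow> complex \<Rightarrow> complex \<Rightarrow> nat \<Rightarrow> nat \<Rightarrow> complex" where
  "Opsi a b c d j = (if even j
     then (2 * b - of_nat d - 1 + of_nat j) * (2 * b - of_nat d - 1 + 2 * of_nat j - 2 * a - 2 * c) / 2
     else (2 * b + of_nat j) * (2 * b - of_nat d - 1 + 2 * of_nat j - 2 * a + 2 * c) / 2)"

text \<open>The factored form of the value that the coefficient of v_(j-1) in X y_j forces. The
  denominator is the squared difference of two neighbouring eigenvalues of Y.\<close>

definition Odelta :: "complex \<Rightarrow> complex \<Rightarrow> complex \<Rightarrow> nat \<Rightarrow> nat \<Rightarrow> complex" where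
  "Odelta a b c d j = Ophi a b c d j * Opsi a b c d j / (2 * b - of_nat d + 2 * of_nat j - 1)^2"

text \<open>Back substitution in the upper bidiagonal system (Y - theta_j) y = 0, starting from
  coefficient 1 at v_j.\<close>

definition Oeig :: "complex \<Rightarrow> complex \<Rightarrow> complex \<Rightarrow> nat \<Rightarrow> nat \<Rightarrow> nat vec" where
  "Oeig a b c d j i = (if i \<le> j
     then (\<Prod>h\<in>{i..<j}. Ophi a b c d (Suc h) / (Oth b d j - Oth b d h)) else 0)"

lemma Oeig_self: "Oeig a b c d j j = 1"
  by (simp add: Oeig_def)

lemma Oeig_rec:
  assumes "i < j" and "Oth b d j \<noteq> Oth b d i"
  shows "Oeig a b c d j i = Ophi a b c d (Suc i) / (Oth b d j - Oth b d i) * Oeig a b c d j (Suc i)"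
  using assms by (simp add: Oeig_def prod.atLeast_Suc_lessThan)

lemma OY_Oeig:
  assumes nd: "nondeg b d" and "j \<le> d"
  shows "OY a b c d (Oeig a b c d j) = scal (Oth b d j) (Oeig a b c d j)"
proof
  fix i
  consider "i > j" | "i = j" | "i < j" by linarith
  then show "OY a b c d (Oeig a b c d j) i = scal (Oth b d j) (Oeig a b c d j) i"
  proof cases
    case 3
    then have ne: "Oth b d j \<noteq> Oth b d i" using Oth_neq[OF nd, of j i] assms(2) by simp
    then show ?thesis using 3 assms(2) Oeig_rec[OF 3 ne, of a c]
      by (simp add: OY_tri tri_def scal_def field_simps)
  qed (use assms(2) in \<open>auto simp: OY_tri tri_def scal_def Oeig_def\<close>)
qed

lemma Oomega_0: "Oomega a b c d 0 = 0"
  by (simp add: Oomega_def Ophi_0)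

lemma Oomega_Suc: "even d \<Longrightarrow> Oomega a b c d (Suc d) = 0"
  by (simp add: Oomega_def Ophi_Suc)

text \<open>The polynomial identity behind the factorisation of delta: the expression forced by
  comparing coefficients, with denominators cleared.\<close>

lemma Opsi_eq:
  "(2 * b - of_nat d + 2 * of_nat (Suc j) - 1) * (Oth a d j - Oth a d (Suc j))
     + (-1)^j * Ophi a b c d (Suc j)
     - (-1)^j * (2 * b - of_nat d + 2 * of_nat (Suc j) - 1) * (Ophi a b c d j - Ophi a b c d (Suc (Suc j))) / 2
   = - ((-1)^j) * Opsi a b c d (Suc j)"
  by (cases "even j") (simp_all add: Oth_def Ophi_def Opsi_def field_simps)

lemma Oth_pred_diff: "Oth b d (Suc j) - Oth b d j = - ((-1)^j * (2 * b - of_nat d + 2 * of_nat (Suc j) - 1))"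
  by (simp add: Oth_def field_simps)

lemma nondegD: "nondeg b d \<Longrightarrow> odd m \<Longrightarrow> m < 2 * d \<Longrightarrow> 2 * b - of_nat d + of_nat m \<noteq> 0"
  by (simp add: nondeg_def)

lemma nondeg_odd: "nondeg b d \<Longrightarrow> Suc j \<le> d \<Longrightarrow> 2 * b - of_nat d + 2 * of_nat (Suc j) - 1 \<noteq> 0"
  using nondegD[of b d "Suc (2 * j)"] by (simp add: algebra_simps)

lemma Oomega_eq:
  assumes "nondeg b d" "Suc j \<le> d"
  shows "Ophi a b c d (Suc j) = - ((-1)^j) * Oomega a b c d (Suc j) * (2 * b - of_nat d + 2 * of_nat (Suc j) - 1)"
proof -
  have "(-1)^j * ((-1)^j * x) = x" for x :: complex
    by (simp add: mult.assoc[symmetric] power_mult_distrib[symmetric])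
  then show ?thesis using nondeg_odd[OF assms] by (simp add: Oomega_def mult.assoc del: of_nat_Suc)
qed

lemma Oeig_pred:
  assumes "nondeg b d" "Suc j \<le> d"
  shows "Oeig a b c d (Suc j) j = Oomega a b c d (Suc j)"
proof -
  have "Oth b d (Suc j) \<noteq> Oth b d j" using assms by (intro Oth_neq) auto
  then show ?thesis
    by (simp add: Oeig_rec Oeig_self Oth_pred_diff Oomega_def divide_simps del: of_nat_Suc)
qed

lemma Oeig_pred2:
  assumes "nondeg b d" "Suc (Suc j) \<le> d"
  shows "Oeig a b c d (Suc (Suc j)) j = (-1)^j / 2 * Ophi a b c d (Suc j) * Oomega a b c d (Suc (Suc j))"
proof -
  have ne: "Oth b d (Suc (Suc j)) \<noteq> Oth b d j" using assms by (intro Oth_neq) auto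
  have df: "Oth b d (Suc (Suc j)) - Oth b d j = 2 * (-1)^j" by (simp add: Oth_Suc)
  have "Oeig a b c d (Suc (Suc j)) j = Ophi a b c d (Suc j) / (2 * (-1)^j) * Oomega a b c d (Suc (Suc j))"
    using Oeig_rec[of j "Suc (Suc j)" b d a c] ne Oeig_pred[OF assms, of a c] by (simp only: df) simp
  then show ?thesis by (cases "even j") auto
qed

text \<open>This compares the coefficients of v_j in the expansion of X y_(j+1). After
  multiplication by the denominator D of omega_(j+1), only \<open>Opsi_eq\<close> and the square of
  a sign remain.\<close>

lemma Odelta_eq:
  assumes nd: "nondeg b d" and ev: "even d" and j: "Suc j \<le> d"
  shows "Oth a d j * Oomega a b c d (Suc j) + (-1)^(Suc j) / 2 * Ophi a b c d j * Oomega a b c d (Suc j)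
    = (-1)^j / 2 * Ophi a b c d (Suc j) * Oomega a b c d (Suc (Suc j))
      + Oalpha a b c d (Suc j) * Oomega a b c d (Suc j) + Odelta a b c d (Suc j)"
proof -
  define D where "D = 2 * b - of_nat d + 2 * of_nat (Suc j) - 1"
  define s where "s = (-1::complex)^j"
  define w where "w = Oomega a b c d (Suc j)"
  define x where "x = Oomega a b c d (Suc (Suc j))"
  have D: "D \<noteq> 0" using nondeg_odd[OF nd j] by (simp add: D_def)
  have s: "s * s = 1" by (simp add: s_def power_mult_distrib[symmetric])
  have p: "Ophi a b c d (Suc j) = - s * w * D"
    using Oomega_eq[OF nd j] by (simp add: s_def w_def D_def)
  \<comment> \<open>At j + 1 = d nondegeneracy says nothing about the next denominator D + 2, but
    phi and omega both vanish at d + 1.\<close>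
  have p': "Ophi a b c d (Suc (Suc j)) = s * x * (D + 2)"
  proof (cases "Suc j = d")
    case True
    then show ?thesis using ev by (simp add: x_def Oomega_Suc Ophi_Suc)
  next
    case False
    then show ?thesis using j Oomega_eq[OF nd, of "Suc j" a c] by (simp add: s_def x_def D_def algebra_simps)
  qed
  have dl: "Odelta a b c d (Suc j) * D = - s * w * Opsi a b c d (Suc j)"
    using D by (simp add: Odelta_def p D_def[symmetric] power2_eq_square del: of_nat_Suc)
  have psi: "D * (Oth a d j - Oth a d (Suc j)) + s * (- s * w * D)
     - s * D * (Ophi a b c d j - s * x * (D + 2)) / 2 = - s * Opsi a b c d (Suc j)"
    using Opsi_eq[of b d j a c] unfolding p p' D_def[symmetric] s_def[symmetric] .
  have "D * (Oth a d j * w + (-s) / 2 * Ophi a b c d j * w)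
      = D * (s / 2 * (- s * w * D) * x + (Oth a d (Suc j) + w - x) * w + Odelta a b c d (Suc j))"
    using dl psi s by algebra
  then have "Oth a d j * w + (-s) / 2 * Ophi a b c d j * w
      = s / 2 * (- s * w * D) * x + (Oth a d (Suc j) + w - x) * w + Odelta a b c d (Suc j)"
    using D by (simp only: mult_cancel_left)  simp
  then show ?thesis unfolding p Oalpha_def w_def[symmetric] x_def[symmetric] power_Suc s_def[symmetric] by simp
qed

text \<open>Write $r$ for the difference of the two sides. The coefficients of $v_{j+1}$, $v_j$, $v_{j-1}$ in $r$ vanish
  by the choice of the constants, and $((Y + \theta_j)^2 - 1) r$ is a multiple of the eigenvector because
  $(Y + \theta_j)^2 - 1$ has exactly the roots $\theta_{j-1}$ and $\theta_{j+1}$; so $r = 0$ by looking at its top coefficient.\<close>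
lemma OX_Oeig:
  assumes ev: "even d" and nd: "nondeg b d" and j: "j \<le> d"
  shows "OX a d (Oeig a b c d j) i = (if j < d then Oeig a b c d (Suc j) i else 0)
     + Oalpha a b c d j * Oeig a b c d j i + (if j = 0 then 0 else Odelta a b c d j * Oeig a b c d (j - 1) i)"
proof -
  let ?A = "OY a b c d" and ?B = "OX a d" and ?Z = "OZ a b c d" and ?y = "Oeig a b c d" and ?t = "Oth b d"
  let ?ka = "2 * a * b - c * (of_nat d + 1)" and ?la = "2 * b * c - a * (of_nat d + 1)"
  have yfin: "?y k \<in> finvec d" if "k \<le> d" for k using that by (auto simp: finvec_def Oeig_def)
  define r where "r = (\<lambda>i. ?B (?y j) i - (if j < d then ?y (Suc j) i else 0)
     - Oalpha a b c d j * ?y j i - (if j = 0 then 0 else Odelta a b c d j * ?y (j - 1) i))"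
  define N where "N v i = ?A (?A v) i + 2 * ?t j * ?A v i + ((?t j)^2 - 1) * v i" for v i
  have Alin: "?A (vadd u v) = vadd (?A u) (?A v)" "?A (vsub u v) = vsub (?A u) (?A v)"
    "?A (scal e u) = scal e (?A u)" for u v e
    by (simp_all add: OY_tri tri_linear)
  have Nlin: "N (vsub u v) i = N u i - N v i" "N (scal e u) i = e * N u i" for u v e i
    by (simp_all add: N_def Alin) (simp_all add: vsub_def scal_def algebra_simps)
  have Ny: "N (?y k) i = ((?t k + ?t j)^2 - 1) * ?y k i" if "k \<le> d" for k i
    using that by (simp add: N_def OY_Oeig[OF nd] Alin) (simp add: scal_def power2_eq_square algebra_simps)
  \<comment> \<open>Substituting Z = {X,Y} - kappa into {Y,Z} - X = lambda gives Y^2 X + 2 Y X Y + X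
    Y^2 - X = 2 kappa Y + lambda. On y_j every Y to the right of X becomes theta_j.\<close>
  have NB: "N (?B (?y j)) i = (2 * ?ka * ?t j + ?la) * ?y j i" for i
  proof -
    have 1: "?Z (?y j) = anticomm ?B ?A ?ka (?y j)"
      using yfin[OF j] by (auto simp: OZ_def anticomm_def vec_defs fun_eq_iff finvec_def OX_tri OY_tri tri_def)
    have 2: "?A (?Z (?y j)) i = ?A (?A (?B (?y j))) i + ?t j * ?A (?B (?y j)) i - ?ka * ?t j * ?y j i"
      by (simp add: 1 anticomm_def Alin OY_Oeig[OF nd j] OX_tri tri_linear) (simp add: vec_defs)
    have 3: "?Z (?A (?y j)) i = ?t j * (?A (?B (?y j)) i + ?t j * ?B (?y j) i - ?ka * ?y j i)"
    proof -
      have "?Z (?A (?y j)) = scal (?t j) (?Z (?y j))"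
        by (simp add: OY_Oeig[OF nd j] OZ_tri[OF ev] tri_linear)
      moreover have "?B (scal (?t j) (?y j)) = scal (?t j) (?B (?y j))"
        by (simp add: OX_tri tri_linear)
      ultimately show ?thesis
        by (simp add: 1 anticomm_def OY_Oeig[OF nd j]) (simp add: vec_defs algebra_simps)
    qed
    have 4: "?B (?y j) i = ?A (?Z (?y j)) i + ?Z (?A (?y j)) i - ?la * ?y j i"
      using anticomm_YZ[OF ev yfin[OF j], of a b c i] by (simp add: anticomm_def vec_defs)
    show ?thesis using 4 unfolding 2 3 N_def by (simp add: algebra_simps power2_eq_square)
  qed
  have rfin: "r i = 0" if "i > d" for i
    using that j by (auto simp: r_def OX_def Oeig_def)
  have r_top: "r i = 0" if "i > j" for i
    using that j by (auto simp: r_def OX_def Oeig_def OX_tri tri_def)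
  have r_j: "r j = 0"
  proof -
    have "?B (?y j) j = Oth a d j + Oomega a b c d j"
      using j Oeig_pred[OF nd, of "j - 1" a c] by (cases j) (auto simp: OX_tri tri_def Oeig_self Oomega_0)
    moreover have "(if j < d then ?y (Suc j) j else 0) = Oomega a b c d (Suc j)"
      using j Oeig_pred[OF nd, of j a c] Oomega_Suc[OF ev] by (cases "j = d") auto
    moreover have "?y (j - 1) j = 0" if "j \<noteq> 0" using that by (simp add: Oeig_def)
    ultimately show ?thesis by (auto simp: r_def Oeig_self Oalpha_def)
  qed
  have r_p: "r k = 0" if k: "j = Suc k" for k
  proof -
    have kd: "Suc k \<le> d" using j k by simp
    have "?B (?y j) k = Oth a d k * Oomega a b c d (Suc k) + (-1)^(Suc k) / 2 * Ophi a b c d k * Oomega a b c d (Suc k)"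
      using k kd Oeig_pred[OF nd kd, of a c] Oeig_pred2[OF nd, of "k - 1" a c]
      by (cases k) (auto simp: OX_tri tri_def Ophi_0)
    moreover have "(if j < d then ?y (Suc j) k else 0) = (-1)^k / 2 * Ophi a b c d (Suc k) * Oomega a b c d (Suc (Suc k))"
      using k kd Oeig_pred2[OF nd, of k a c] Oomega_Suc[OF ev] by (cases "j = d") auto
    ultimately show ?thesis
      using Odelta_eq[OF nd ev kd, of a c] Oeig_pred[OF nd kd, of a c]
      by (simp add: r_def k Oeig_self)
  qed
  have Nr: "\<exists>e. \<forall>i. N r i = e * ?y j i"
  proof -
    have r: "r = vsub (vsub (vsub (?B (?y j)) (scal (if j < d then 1 else 0) (?y (if j < d then Suc j else j))))
       (scal (Oalpha a b c d j) (?y j))) (scal (if j = 0 then 0 else Odelta a b c d j) (?y (j - 1)))"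
      by (auto simp: r_def vec_defs fun_eq_iff)
    have up: "(?t (Suc j) + ?t j)^2 - 1 = 0"
      by (simp add: Oth_Suc power_mult_distrib[symmetric] power2_eq_square)
    have dn: "(?t (j - 1) + ?t j)^2 - 1 = 0" if "j \<noteq> 0"
      using that by (cases j) (simp_all add: Oth_Suc power_mult_distrib[symmetric] power2_eq_square)
    have "N r i = (2 * ?ka * ?t j + ?la - Oalpha a b c d j * ((?t j + ?t j)^2 - 1)) * ?y j i" for i
    proof -
      have u: "(if j < d then 1 else 0) * N (?y (if j < d then Suc j else j)) i = 0"
        using up Ny[of "Suc j" i] by simp
      have l: "(if j = 0 then 0 else Odelta a b c d j) * N (?y (j - 1)) i = 0"
        using dn j Ny[of "j - 1" i] by simp
      show ?thesis
        by (simp only: r Nlin u l NB Ny[OF j]) (simp add: algebra_simps)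
    qed
    then show ?thesis by blast
  qed
  have "r i = 0" for i
  proof (rule ccontr)
    assume ri: "r i \<noteq> 0"
    let ?S = "{i. r i \<noteq> 0}"
    have fS: "finite ?S" by (rule finite_subset[of _ "{..d}"]) (auto intro: leI rfin)
    define m where "m = Max ?S"
    have rm: "r m \<noteq> 0" using Max_in[OF fS] ri unfolding m_def by blast
    have gm: "r k = 0" if "k > m" for k using that Max_ge[OF fS, of k] unfolding m_def by fastforce
    have md: "m \<le> d" using rfin rm by (meson not_le)
    have Am: "?A v m = ?t m * v m" if "\<And>k. k > m \<Longrightarrow> v k = 0" for v
      using that md by (auto simp: OY_tri tri_def)
    have Ag: "?A r k = 0" if "k > m" for k
      using that gm by (auto simp: OY_tri tri_def)
    have Nm: "N r m = ((?t m + ?t j)^2 - 1) * r m"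
      unfolding N_def using Am[OF gm] Am[OF Ag] by (simp add: power2_eq_square algebra_simps)
    have mj: "m < j" using r_top r_j rm by (metis linorder_neqE_nat)
    then obtain k where k: "j = Suc k" by (cases j) auto
    have mk: "m < k" using mj rm r_p[OF k] k by (metis less_antisym)
    \<comment> \<open>N is upper triangular and r vanishes from index j on, so N r vanishes at j.
      There y_j equals 1, which makes the multiple of y_j zero.\<close>
    have y0: "?y j m = 0 \<or> N r j = 0"
    proof -
      have Aj: "?A v j = 0" if "\<And>k. k \<ge> j \<Longrightarrow> v k = 0" for v
        using that by (auto simp: OY_tri tri_def)
      have z: "r k = 0" if "k \<ge> j" for k using that mj gm by simp
      have "?A r k = 0" if "k \<ge> j" for k using that z by (auto simp: OY_tri tri_def)
      then show ?thesis unfolding N_def using Aj z by simp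
    qed
    moreover have "N r m = 0"
    proof -
      obtain e where e: "N r i = e * ?y j i" for i using Nr by blast
      then show ?thesis using y0 e[of j] e[of m] by (auto simp: Oeig_self)
    qed
    then have "(?t m + ?t j)^2 = 1" using Nm rm by simp
    then have "(?t m - ?t k) * (?t m - ?t (Suc j)) = 0"
    proof -
      assume sq: "(?t m + ?t j)^2 = 1"
      have aux: "(x - y) * (x - z) = 0" if "w = - y - s" "z = - w + s" "s^2 = 1" "(x + w)^2 = 1"
        for x y z w s :: complex using that by algebra
      have s: "((-1::complex)^k)^2 = 1" by (simp add: power_mult_distrib[symmetric] power2_eq_square)
      have "?t j = - ?t k - (-1)^k" "?t (Suc j) = - ?t j + (-1)^k"
        using Oth_Suc[of b d j] Oth_Suc[of b d k] k by simp_all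
      then show ?thesis using aux s sq by blast
    qed
    moreover have "?t m \<noteq> ?t k" using mk j k by (intro Oth_neq[OF nd]) auto
    \<comment> \<open>The index j + 1 may be d + 1. Since m is at most j - 2, the sum m + j + 1 is
      below 2 d, which explains the range in \<open>nondeg\<close>.\<close>
    moreover have "?t m \<noteq> ?t (Suc j)" using mk j k by (intro Oth_neq[OF nd]) auto
    ultimately show False by simp
  qed
  from this[of i] show ?thesis unfolding r_def by (simp add: algebra_simps)
qed

lemma sum_atMost_shift_if:
  fixes g :: "nat \<Rightarrow> complex"
  shows "(\<Sum>j\<le>d. if j < d then g j else 0) = (\<Sum>j\<le>d. if j = 0 then 0 else g (j - 1))"
proof -
  have "(\<Sum>j\<le>d. if j < d then g j else 0) = (\<Sum>j<d. g j)"
    by (simp add: lessThan_Suc_atMost[symmetric])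
  also have "\<dots> = (\<Sum>j\<le>d. if j = 0 then 0 else g (j - 1))"
    by (simp add: sum.atMost_shift)
  finally show ?thesis .
qed

definition Omap :: "complex \<Rightarrow> complex \<Rightarrow> complex \<Rightarrow> nat \<Rightarrow> nat vec \<Rightarrow> nat vec" where
  "Omap a b c d w i = (\<Sum>j\<le>d. w j * Oeig a b c d j i)"

lemma Omap_finvec: "Omap a b c d w \<in> finvec d"
  by (auto simp: finvec_def Omap_def Oeig_def intro: sum.neutral)

lemma Omap_linear:
  "Omap a b c d (vadd u v) = vadd (Omap a b c d u) (Omap a b c d v)"
  "Omap a b c d (vsub u v) = vsub (Omap a b c d u) (Omap a b c d v)"
  "Omap a b c d (scal e u) = scal e (Omap a b c d u)"
  by (auto simp: Omap_def vec_defs fun_eq_iff algebra_simps sum.distrib sum_subtractf sum_distrib_left)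

lemma tri_sum: "tri d p q r (\<lambda>i. \<Sum>j\<in>A. w j * y j i) i = (\<Sum>j\<in>A. w j * tri d p q r (y j) i)"
  by (auto simp: tri_def sum.distrib sum_distrib_left algebra_simps)

lemma OY_Omap:
  assumes "nondeg b d"
  shows "OY a b c d (Omap a b c d w) = Omap a b c d (tri d (\<lambda>_. 0) (Oth b d) (\<lambda>_. 0) w)"
proof
  fix i
  have "OY a b c d (Omap a b c d w) i = (\<Sum>j\<le>d. w j * OY a b c d (Oeig a b c d j) i)"
    unfolding Omap_def OY_tri by (rule tri_sum)
  also have "\<dots> = Omap a b c d (tri d (\<lambda>_. 0) (Oth b d) (\<lambda>_. 0) w) i"
    unfolding Omap_def tri_diag by (rule sum.cong) (auto simp: OY_Oeig[OF assms] scal_def)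
  finally show "OY a b c d (Omap a b c d w) i = Omap a b c d (tri d (\<lambda>_. 0) (Oth b d) (\<lambda>_. 0) w) i" .
qed

lemma OX_Omap:
  assumes "even d" "nondeg b d"
  shows "OX a d (Omap a b c d w) = Omap a b c d (tri d (\<lambda>_. 1) (Oalpha a b c d) (Odelta a b c d) w)"
proof
  fix i
  let ?y = "\<lambda>j. Oeig a b c d j i" and ?al = "Oalpha a b c d" and ?dl = "Odelta a b c d"
  have "OX a d (Omap a b c d w) i = (\<Sum>j\<le>d. w j * OX a d (Oeig a b c d j) i)"
    unfolding Omap_def OX_tri by (rule tri_sum)
  also have "\<dots> = (\<Sum>j\<le>d. (if j < d then w j * ?y (Suc j) else 0) + ?al j * w j * ?y j
      + (if j = 0 then 0 else w (Suc (j - 1)) * ?dl (Suc (j - 1)) * ?y (j - 1)))"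
    by (rule sum.cong) (auto simp: OX_Oeig[OF assms] algebra_simps)
  also have "\<dots> = (\<Sum>j\<le>d. if j = 0 then 0 else w (j - 1) * ?y (Suc (j - 1))) + (\<Sum>j\<le>d. ?al j * w j * ?y j)
      + (\<Sum>j\<le>d. if j < d then w (Suc j) * ?dl (Suc j) * ?y j else 0)"
    unfolding sum.distrib
      sum_atMost_shift_if[of d "\<lambda>j. w j * ?y (Suc j)"] sum_atMost_shift_if[of d "\<lambda>j. w (Suc j) * ?dl (Suc j) * ?y j"] ..
  also have "\<dots> = Omap a b c d (tri d (\<lambda>_. 1) ?al ?dl w) i"
    unfolding Omap_def sum.distrib[symmetric] by (rule sum.cong) (auto simp: tri_def algebra_simps)
  finally show "OX a d (Omap a b c d w) i = Omap a b c d (tri d (\<lambda>_. 1) ?al ?dl w) i" .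
qed

text \<open>The eigenvectors form a unitriangular matrix. The largest index where two inputs differ
  is visible in the output, and subtracting v_m y_m lowers the largest index in the support of a
  target.\<close>

lemma bij_betw_Omap: "bij_betw (Omap a b c d) (finvec d) (finvec d)"
proof -
  have "inj_on (Omap a b c d) (finvec d)"
  proof (rule inj_onI, rule ccontr)
    fix u v assume u: "u \<in> finvec d" and v: "v \<in> finvec d"
      and eq: "Omap a b c d u = Omap a b c d v" and ne: "u \<noteq> v"
    let ?S = "{i. u i \<noteq> v i}"
    have fS: "finite ?S"
      by (rule finite_subset[of _ "{..d}"]) (use u v in \<open>auto simp: finvec_def, metis not_le\<close>)
    define m where "m = Max ?S"
    have "?S \<noteq> {}" using ne by auto
    then have um: "u m \<noteq> v m" using Max_in[OF fS] unfolding m_def by blast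
    have gm: "u k = v k" if "k > m" for k using that Max_ge[OF fS, of k] unfolding m_def by fastforce
    have md: "m \<le> d" using um u v by (auto simp: finvec_def, metis not_le)
    have "Omap a b c d (vsub u v) m = (\<Sum>j\<le>d. if j = m then u m - v m else 0)"
      unfolding Omap_def
    proof (rule sum.cong)
      fix j show "vsub u v j * Oeig a b c d j m = (if j = m then u m - v m else 0)"
        using gm[of j] by (cases j m rule: linorder_cases) (auto simp: vsub_def Oeig_self, auto simp: Oeig_def)
    qed simp
    also have "\<dots> = u m - v m" using md by simp
    finally show False using um eq by (simp add: Omap_linear) (simp add: vsub_def)
  qed
  moreover have surj: "\<exists>w\<in>finvec d. Omap a b c d w = v" if "\<And>i. i \<ge> m \<Longrightarrow> v i = 0" "m \<le> Suc d" for m v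
    using that
  proof (induction m arbitrary: v)
    case 0
    then have "v = vzero" by (auto simp: vzero_def)
    moreover have "Omap a b c d vzero = vzero" by (simp add: Omap_def vzero_def fun_eq_iff)
    ultimately show ?case using csubspace_finvec[of d] by (auto simp: csubspace_def)
  next
    case (Suc m)
    let ?v = "vsub v (scal (v m) (Oeig a b c d m))"
    have "?v i = 0" if "i \<ge> m" for i
      using Suc.prems(1)[of i] that by (cases "i = m") (auto simp: vec_defs Oeig_self, auto simp: Oeig_def)
    then obtain w where w: "w \<in> finvec d" "Omap a b c d w = ?v" using Suc.IH[of ?v] Suc.prems(2) by auto
    have "Omap a b c d (unitv m) = Oeig a b c d m"
      using Suc.prems(2) by (auto simp: Omap_def unitv_def fun_eq_iff if_distrib[of "\<lambda>x. x * _"] cong: if_cong)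
    then have "Omap a b c d (vadd w (scal (v m) (unitv m))) = v"
      by (simp add: Omap_linear w) (simp add: vec_defs)
    moreover have "vadd w (scal (v m) (unitv m)) \<in> finvec d"
      using w(1) Suc.prems(2) by (auto simp: finvec_def vec_defs unitv_def)
    ultimately show ?case by blast
  qed
  moreover have "finvec d \<subseteq> Omap a b c d ` finvec d"
  proof
    fix v assume "v \<in> finvec d"
    then have "\<exists>w\<in>finvec d. Omap a b c d w = v"
      by (intro surj[of "Suc d"]) (auto simp: finvec_def)
    then show "v \<in> Omap a b c d ` finvec d" by blast
  qed
  ultimately show ?thesis unfolding bij_betw_def using Omap_finvec by blast
qed

lemma OZ_anticomm:
  "v \<in> finvec d \<Longrightarrow> OZ a b c d v = anticomm (OX a d) (OY a b c d) (2 * a * b - c * (of_nat d + 1)) v"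
  by (auto simp: OZ_def anticomm_def vec_defs fun_eq_iff finvec_def OX_tri OY_tri tri_def)

section \<open>Twists of O_d in an eigenbasis of X\<close>

lemma carrier_Omod: "carrier (Omod d a b c) = finvec d"
  by (simp add: Omod_def finvec_def)

lemma act_Omod: "act (Omod d a b c) = case_gen (OX a d) (OY a b c d) (OZ a b c d)"
  by (auto simp: Omod_def fun_eq_iff split: gen.split)

lemma carrier_twist: "carrier (twist M e) = carrier M"
  by (simp add: twist_def)

lemma act_twist: "act (twist M e) g v = scal (fst (e g)) (act M (snd (e g)) v)"
  by (simp add: twist_def)

lemma bi_closed_Omod: "even d \<Longrightarrow> bi_closed (Omod d a b c)"
  unfolding bi_closed_def bi_submodule_def
  by (auto simp: carrier_Omod csubspace_finvec act_Omod OX_tri OY_tri OZ_tri tri_finvec split: gen.split)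

lemma bi_closed_twist: "bi_closed M \<Longrightarrow> bi_closed (twist M e)"
  unfolding bi_closed_def bi_submodule_def csubspace_def by (auto simp: carrier_twist act_twist)

text \<open>The values e = -1 and e = 1 are the twists of W_1 and W_2, so both are treated
  together.\<close>

definition cyc_aut :: "complex \<Rightarrow> aut" where
  "cyc_aut e = case_gen (e, GY) (1, GZ) (e, GX)"

text \<open>Reversing the basis of $O_d(a,b,c)$ exchanges upper and lower bidiagonal matrices, which turns its twist by
  $X \mapsto -Y$, $Y \mapsto -X$ into $O_d(-b,-a,c)$.\<close>
definition neg_swap :: aut where
  "neg_swap = case_gen (-1, GY) (-1, GX) (1, GZ)"

lemma scal_1: "scal 1 v = v"
  by (simp add: scal_def)

lemma scal_scal: "scal a (scal b v) = scal (a * b) v"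
  by (simp add: scal_def mult.assoc)

text \<open>In this twist X acts as e Y and is diagonal in the eigenbasis. Y acts as Z = {X,Y} -
  kappa, whose off-diagonal entries are those of X times sums of neighbouring eigenvalues, that is,
  signs. The constant for Z comes from \<open>anticomm_YZ\<close>, multiplied by e.\<close>

lemma bi_iso_cyc_aut:
  assumes ev: "even d" and nd: "nondeg b d"
  shows "bi_iso (Tmod d (\<lambda>i. e * Oth b d i)
      (\<lambda>i. 2 * Oth b d i * Oalpha a b c d i - (2 * a * b - c * (of_nat d + 1)))
      (\<lambda>i. (-1)^i) (\<lambda>i. (-1)^i * Odelta a b c d i) (e * (2 * b * c - a * (of_nat d + 1))))
    (twist (Omod d a b c) (cyc_aut e))" (is "bi_iso ?M ?N")
proof -
  let ?S = "Omap a b c d" and ?D = "tri d (\<lambda>_. 0) (Oth b d) (\<lambda>_. 0)"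
    and ?T = "tri d (\<lambda>_. 1) (Oalpha a b c d) (Odelta a b c d)" and ?ka = "2 * a * b - c * (of_nat d + 1)"
  have cM: "carrier ?M = finvec d" by (simp add: Tmod_def)
  have cN: "carrier ?N = finvec d" by (simp add: carrier_twist carrier_Omod)
  have "bi_hom ?M ?N ?S"
  proof (rule bi_hom_of_XY)
    show "clinear_on (carrier ?M) ?S" by (simp add: clinear_on_def Omap_linear)
    show "?S ` carrier ?M \<subseteq> carrier ?N" using Omap_finvec by (auto simp: cN)
    fix w assume w: "w \<in> carrier ?M"
    have "tri d (\<lambda>_. 0) (\<lambda>i. e * Oth b d i) (\<lambda>_. 0) w = scal e (?D w)"
      by (auto simp: tri_diag scal_def)
    then show "?S (act ?M GX w) = act ?N GX (?S w)"
      by (simp add: Tmod_def act_twist cyc_aut_def act_Omod OY_Omap[OF nd] Omap_linear)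
    have "act ?M GY w = anticomm ?T ?D ?ka w"
    proof
      fix i show "act ?M GY w i = anticomm ?T ?D ?ka w i"
        using w unfolding cM
        by (cases i) (auto simp: Tmod_def anticomm_def tri_def vec_defs finvec_def Oth_Suc algebra_simps)
    qed
    then show "?S (act ?M GY w) = act ?N GY (?S w)"
      by (simp add: act_twist cyc_aut_def act_Omod OZ_anticomm[OF Omap_finvec] anticomm_def
          OX_Omap[OF ev nd] OY_Omap[OF nd] Omap_linear scal_1)
  next
    fix v assume v: "v \<in> carrier ?N"
    have X: "OX a d v = anticomm (OY a b c d) (OZ a b c d) (2 * b * c - a * (of_nat d + 1)) v"
      using anticomm_YZ[OF ev, of v a b c] v by (auto simp: cN)
    have "act ?N GZ v = scal e (OX a d v)" by (simp add: act_twist cyc_aut_def act_Omod)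
    also have "\<dots> = anticomm (act ?N GX) (act ?N GY) (e * (2 * b * c - a * (of_nat d + 1))) v"
      by (simp add: X act_twist cyc_aut_def act_Omod anticomm_def scal_1 OZ_tri[OF ev] tri_linear)
         (simp add: vec_defs algebra_simps)
    finally show "act ?N GZ v = anticomm (act ?N GX) (act ?N GY) (e * (2 * b * c - a * (of_nat d + 1))) v" .
  qed (auto simp: bi_closed_Tmod, auto simp: Tmod_def)
  then show ?thesis unfolding bi_iso_def cM cN using bij_betw_Omap by blast
qed

lemma anticomm_scal:
  assumes "\<And>x u. A (scal x u) = scal x (A u)" "\<And>x u. B (scal x u) = scal x (B u)"
  shows "anticomm (\<lambda>v. scal (-1) (A v)) (\<lambda>v. scal (-1) (B v)) k v = anticomm B A k v"
  by (simp add: anticomm_def assms scal_scal) (simp add: vec_defs fun_eq_iff)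

lemma anticomm_neg_swap:
  assumes "v \<in> finvec d"
  shows "act (twist (Omod d a b c) neg_swap) GZ v
    = anticomm (act (twist (Omod d a b c) neg_swap) GX) (act (twist (Omod d a b c) neg_swap) GY)
        (2 * a * b - c * (of_nat d + 1)) v"
proof -
  have X: "act (twist (Omod d a b c) neg_swap) GX = (\<lambda>v. scal (-1) (OY a b c d v))"
    and Y: "act (twist (Omod d a b c) neg_swap) GY = (\<lambda>v. scal (-1) (OX a d v))"
    by (auto simp: act_twist neg_swap_def act_Omod)
  have "anticomm (\<lambda>v. scal (-1) (OY a b c d v)) (\<lambda>v. scal (-1) (OX a d v))
      (2 * a * b - c * (of_nat d + 1)) v = OZ a b c d v"
    unfolding OZ_anticomm[OF assms] by (rule anticomm_scal) (simp_all add: OX_tri OY_tri tri_linear)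
  then show ?thesis unfolding X Y by (simp add: act_twist neg_swap_def act_Omod scal_1)
qed

lemma bi_iso_neg_swap:
  assumes ev: "even d" and nd: "nondeg b d"
  shows "bi_iso (Tmod d (\<lambda>i. - Oth b d i) (\<lambda>i. - Oalpha a b c d i) (\<lambda>_. -1) (\<lambda>i. - Odelta a b c d i)
      (2 * a * b - c * (of_nat d + 1)))
    (twist (Omod d a b c) neg_swap)" (is "bi_iso ?M ?N")
proof -
  let ?S = "Omap a b c d" and ?D = "tri d (\<lambda>_. 0) (Oth b d) (\<lambda>_. 0)"
    and ?T = "tri d (\<lambda>_. 1) (Oalpha a b c d) (Odelta a b c d)" and ?ka = "2 * a * b - c * (of_nat d + 1)"
  have cM: "carrier ?M = finvec d" by (simp add: Tmod_def)
  have cN: "carrier ?N = finvec d" by (simp add: carrier_twist carrier_Omod)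
  have "bi_hom ?M ?N ?S"
  proof (rule bi_hom_of_XY)
    show "clinear_on (carrier ?M) ?S" by (simp add: clinear_on_def Omap_linear)
    show "?S ` carrier ?M \<subseteq> carrier ?N" using Omap_finvec by (auto simp: cN)
    fix w assume w: "w \<in> carrier ?M"
    have "act ?M GX w = scal (-1) (?D w)"
      by (auto simp: Tmod_def tri_diag scal_def)
    then show "?S (act ?M GX w) = act ?N GX (?S w)"
      by (simp add: act_twist neg_swap_def act_Omod OY_Omap[OF nd] Omap_linear)
    have "act ?M GY w = scal (-1) (?T w)"
      by (auto simp: Tmod_def tri_def scal_def)
    then show "?S (act ?M GY w) = act ?N GY (?S w)"
      by (simp add: act_twist neg_swap_def act_Omod OX_Omap[OF ev nd] Omap_linear)
  next
    fix v assume "v \<in> carrier ?N"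
    then show "act ?N GZ v = anticomm (act ?N GX) (act ?N GY) ?ka v"
      unfolding cN by (rule anticomm_neg_swap)
  qed (auto simp: bi_closed_Tmod, auto simp: Tmod_def)
  then show ?thesis unfolding bi_iso_def cM cN using bij_betw_Omap by blast
qed

lemma Ophi_reflect:
  assumes "even d" "j \<le> Suc d"
  shows "Ophi (- b) (- a) c d j = Ophi a b c d (Suc d - j)"
proof -
  have "even (Suc d - j) \<longleftrightarrow> odd j" using assms by auto
  then show ?thesis using assms(2) by (auto simp: Ophi_def field_simps)
qed

lemma Oth_reflect:
  assumes "even d" "j \<le> d"
  shows "Oth (- b) d j = - Oth b d (d - j)"
proof -
  have "(-1::complex)^(d - j) = (-1)^j" using assms by (auto simp: uminus_power_if)
  then show ?thesis using assms(2) by (simp add: Oth_def field_simps)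
qed

lemma bi_iso_Omod_reflect:
  assumes ev: "even d" and nz: "\<And>j. 1 \<le> j \<Longrightarrow> j \<le> d \<Longrightarrow> Ophi a b c d j \<noteq> 0"
  shows "bi_iso (twist (Omod d a b c) neg_swap) (Omod d (- b) (- a) c)" (is "bi_iso ?M ?N")
proof -
  \<comment> \<open>Chosen so that the reversed superdiagonal of -Y becomes the subdiagonal 1
    required of X.\<close>
  define s where "s i = (\<Prod>h\<in>{1..i}. - 1 / Ophi a b c d (Suc d - h))" for i
  have s0: "s i \<noteq> 0" if "i \<le> d" for i
    using that nz by (auto simp: s_def)
  have sS: "s i = - s (Suc i) * Ophi a b c d (d - i)" if "i < d" for i
    using that nz[of "d - i"] by (simp add: s_def)
  let ?f = "\<lambda>v i. if i \<le> d then s i * v (d - i) else 0"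
  have cM: "carrier ?M = finvec d" by (simp add: carrier_twist carrier_Omod)
  have cN: "carrier ?N = finvec d" by (simp add: carrier_Omod)
  have hom: "bi_hom ?M ?N ?f"
  proof (rule bi_hom_of_XY)
    fix v assume "v \<in> carrier ?M"
    show "?f (act ?M GX v) = act ?N GX (?f v)"
    proof
      fix i
      show "?f (act ?M GX v) i = act ?N GX (?f v) i"
      proof (cases i)
        case 0
        then show ?thesis
          by (simp add: act_twist neg_swap_def act_Omod OX_tri OY_tri tri_def scal_def Oth_reflect[OF ev])
      next
        case (Suc k)
        have "Suc (d - Suc k) = d - k" if "k < d" using that by simp
        then show ?thesis using Suc sS[of k]
          by (auto simp: act_twist neg_swap_def act_Omod OX_tri OY_tri tri_def scal_def Oth_reflect[OF ev]
              algebra_simps)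
      qed
    qed
    show "?f (act ?M GY v) = act ?N GY (?f v)"
    proof
      fix i
      show "?f (act ?M GY v) i = act ?N GY (?f v) i"
        using sS[of i]
        by (auto simp: act_twist neg_swap_def act_Omod OX_tri OY_tri tri_def scal_def Oth_reflect[OF ev]
            Ophi_reflect[OF ev] algebra_simps)
    qed
  next
    fix v assume "v \<in> carrier ?M"
    then show "act ?M GZ v = anticomm (act ?M GX) (act ?M GY) (2 * a * b - c * (of_nat d + 1)) v"
      unfolding cM by (rule anticomm_neg_swap)
  next
    fix v assume "v \<in> carrier ?N"
    then show "act ?N GZ v = anticomm (act ?N GX) (act ?N GY) (2 * a * b - c * (of_nat d + 1)) v"
      unfolding cN by (simp add: act_Omod OZ_anticomm mult_ac)
  qed (auto simp: cM cN bi_closed_twist bi_closed_Omod ev clinear_on_def vec_defs algebra_simps finvec_def)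
  have "bij_betw ?f (finvec d) (finvec d)"
    by (rule bij_betw_byWitness[where f' = "\<lambda>v i. if i \<le> d then v (d - i) / s (d - i) else 0"])
      (auto simp: finvec_def s0)
  then show ?thesis using hom unfolding bi_iso_def cM cN by blast
qed

section \<open>Isomorphisms between twists of $O_d(a,b,c)$\<close>

lemma Odelta_eq_0: "Ophi a b c d j = 0 \<Longrightarrow> Odelta a b c d j = 0"
  by (simp add: Odelta_def)

text \<open>Keeping b keeps the denominator, and the combined numerators are an exact multiple of
  it, so the difference between the two eigenbases is an integer. At j = d + 1, where the
  denominator may be zero, both omegas vanish.\<close>

lemma Oomega_minus:
  assumes ev: "even d" and nd: "nondeg b d" and j: "j \<le> Suc d"
  shows "(-1)^j * Oomega a b c d j + Oomega (- c) b (- a) d j = (if even j then - of_nat j else 0)"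
proof (cases "j = 0 \<or> j = Suc d")
  case True
  then show ?thesis using ev by (auto simp: Oomega_0 Oomega_Suc)
next
  case False
  let ?D = "2 * b - of_nat d + 2 * of_nat j - 1"
  obtain k where k: "j = Suc k" "Suc k \<le> d" using False j by (cases j) auto
  then have D: "?D \<noteq> 0" using nondeg_odd[OF nd k(2)] by simp
  have "Ophi a b c d j + (-1)^j * Ophi (- c) b (- a) d j = (if even j then - of_nat j else 0) * ?D"
    by (simp add: Ophi_def field_simps)
  moreover have "(-1)^j * ((-1)^j * x) = x" for x :: complex
    by (simp add: mult.assoc[symmetric] power_mult_distrib[symmetric])
  then have "(-1)^j * Oomega a b c d j + Oomega (- c) b (- a) d j = (Ophi a b c d j + (-1)^j * Ophi (- c) b (- a) d j) / ?D"
    by (simp add: Oomega_def add_divide_distrib)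
  ultimately show ?thesis using D by simp
qed

lemma Oomega_swap:
  assumes ev: "even d" and nd: "nondeg b d" and j: "j \<le> Suc d"
  shows "(-1)^j * Oomega a b c d j - Oomega c b a d j = (if even j then 0 else of_nat d + 1 - of_nat j)"
proof (cases "j = 0 \<or> j = Suc d")
  case True
  then show ?thesis using ev by (auto simp: Oomega_0 Oomega_Suc)
next
  case False
  let ?D = "2 * b - of_nat d + 2 * of_nat j - 1"
  obtain k where k: "j = Suc k" "Suc k \<le> d" using False j by (cases j) auto
  then have D: "?D \<noteq> 0" using nondeg_odd[OF nd k(2)] by simp
  have "Ophi a b c d j - (-1)^j * Ophi c b a d j = (if even j then 0 else of_nat d + 1 - of_nat j) * ?D"
    by (simp add: Ophi_def field_simps)
  moreover have "(-1)^j * ((-1)^j * x) = x" for x :: complex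
    by (simp add: mult.assoc[symmetric] power_mult_distrib[symmetric])
  then have "(-1)^j * Oomega a b c d j - Oomega c b a d j = (Ophi a b c d j - (-1)^j * Ophi c b a d j) / ?D"
    by (simp add: Oomega_def diff_divide_distrib)
  ultimately show ?thesis using D by simp
qed

text \<open>Up to sign, 2 theta_j is the denominator of omega_j plus 1, and also the denominator of
  omega_(j+1) minus 1. Hence the product is a phi plus or minus a single omega.\<close>

lemma Oomega_Oth:
  assumes ev: "even d" and nd: "nondeg b d" and j: "j \<le> d"
  shows "2 * Oth b d j * Oomega a b c d j = Ophi a b c d j + (-1)^j * Oomega a b c d j"
    and "2 * Oth b d j * Oomega a b c d (Suc j) = - Ophi a b c d (Suc j) - (-1)^j * Oomega a b c d (Suc j)"
proof -
  show "2 * Oth b d j * Oomega a b c d j = Ophi a b c d j + (-1)^j * Oomega a b c d j"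
  proof (cases j)
    case 0 then show ?thesis by (simp add: Oomega_0 Ophi_0)
  next
    case (Suc k)
    have e: "2 * Oth b d (Suc k) = - ((-1)^k) * ((2 * b - of_nat d + 2 * of_nat (Suc k) - 1) + 1)"
      by (simp add: Oth_def)
    have "Suc k \<le> d" using j Suc by simp
    then show ?thesis unfolding Suc e Oomega_eq[OF nd \<open>Suc k \<le> d\<close>, of a c] power_Suc by (simp add: algebra_simps)
  qed
  show "2 * Oth b d j * Oomega a b c d (Suc j) = - Ophi a b c d (Suc j) - (-1)^j * Oomega a b c d (Suc j)"
  proof (cases "j = d")
    case True then show ?thesis using ev by (simp add: Oomega_Suc Ophi_Suc)
  next
    case False
    then have l: "Suc j \<le> d" using j by simp
    have e: "2 * Oth b d j = (-1)^j * ((2 * b - of_nat d + 2 * of_nat (Suc j) - 1) - 1)"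
      by (simp add: Oth_def)
    show ?thesis unfolding e Oomega_eq[OF nd l, of a c] by (simp add: algebra_simps)
  qed
qed

lemma Oalpha_diag:
  assumes ev: "even d" and nd: "nondeg b d" and j: "j \<le> d"
  shows "2 * Oth b d j * Oalpha a b c d j - (2 * a * b - c * (of_nat d + 1))
    = Ozeta c d j + (-1)^j * Oomega a b c d j + (-1)^j * Oomega a b c d (Suc j)"
  unfolding Oalpha_def Ozeta_eq[of a d j b c, symmetric] right_diff_distrib distrib_left Oomega_Oth[OF assms]
  by (simp add: algebra_simps)

text \<open>Both sides are diagonals of Y in an eigenbasis of X: on the left in the cyclic twist of
  O_d(a,b,c), on the right in the \<open>neg_swap\<close> twist of O_d(-c,b,-a). This is the
  comparison needed for W_1; \<open>Oalpha_swap\<close> serves W_2.\<close>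

lemma Oalpha_minus:
  assumes ev: "even d" and nd: "nondeg b d" and j: "j \<le> d"
  shows "2 * Oth b d j * Oalpha a b c d j - (2 * a * b - c * (of_nat d + 1)) = - Oalpha (- c) b (- a) d j"
proof -
  have aux: "Z + A + B = - (t + x - y)" if "Z + q - q' = - t" "A + x = q" "- B + y = q'"
    for Z A B t x y q q' :: complex using that by algebra
  have "Ozeta c d j + (if even j then - of_nat j else 0) - (if even (Suc j) then - of_nat (Suc j) else 0)
      = - Oth (- c) d j"
    by (simp add: Ozeta_def Oth_def field_simps)
  moreover have "(-1)^j * Oomega a b c d j + Oomega (- c) b (- a) d j = (if even j then - of_nat j else 0)"
    using Oomega_minus[OF ev nd, of j a c] j by simp
  moreover have "- ((-1)^j * Oomega a b c d (Suc j)) + Oomega (- c) b (- a) d (Suc j)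
      = (if even (Suc j) then - of_nat (Suc j) else 0)"
    using Oomega_minus[OF ev nd, of "Suc j" a c] j by simp
  ultimately show ?thesis
    unfolding Oalpha_diag[OF assms] Oalpha_def[of "- c"] by (rule aux)
qed

lemma Oalpha_swap:
  assumes ev: "even d" and nd: "nondeg b d" and j: "j \<le> d"
  shows "2 * Oth b d j * Oalpha a b c d j - (2 * a * b - c * (of_nat d + 1)) = Oalpha c b a d j"
proof -
  have aux: "Z + A + B = t + x - y" if "Z + q - q' = t" "A - x = q" "- B - y = q'"
    for Z A B t x y q q' :: complex
    unfolding that[symmetric] by simp
  have "Ozeta c d j + (if even j then 0 else of_nat d + 1 - of_nat j)
      - (if even (Suc j) then 0 else of_nat d + 1 - of_nat (Suc j)) = Oth c d j"
    by (simp add: Ozeta_def Oth_def field_simps)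
  moreover have "(-1)^j * Oomega a b c d j - Oomega c b a d j = (if even j then 0 else of_nat d + 1 - of_nat j)"
    using Oomega_swap[OF ev nd, of j a c] j by simp
  moreover have "- ((-1)^j * Oomega a b c d (Suc j)) - Oomega c b a d (Suc j)
      = (if even (Suc j) then 0 else of_nat d + 1 - of_nat (Suc j))"
    using Oomega_swap[OF ev nd, of "Suc j" a c] j by simp
  ultimately show ?thesis
    unfolding Oalpha_diag[OF assms] Oalpha_def[of c] by (rule aux)
qed

text \<open>For odd j both phi_j and psi_j are unchanged; for even j their second linear factors
  trade places up to sign.\<close>

lemma Odelta_minus: "Odelta (- c) b (- a) d j = Odelta a b c d j"
proof -
  have "Ophi (- c) b (- a) d j * Opsi (- c) b (- a) d j = Ophi a b c d j * Opsi a b c d j"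
    by (simp add: Ophi_def Opsi_def field_simps)
  then show ?thesis by (simp add: Odelta_def)
qed

lemma Odelta_swap_reflect:
  assumes ev: "even d" and j: "j \<le> Suc d"
  shows "Odelta (- c) (- b) a d (Suc d - j) = Odelta a b c d j"
proof -
  have p: "even (Suc d - j) \<longleftrightarrow> odd j" using assms by auto
  have "Ophi (- c) (- b) a d (Suc d - j) * Opsi (- c) (- b) a d (Suc d - j) = Ophi a b c d j * Opsi a b c d j"
    using j ev by (simp add: Ophi_def Opsi_def p field_simps)
  moreover have "(2 * (- b) - of_nat d + 2 * of_nat (Suc d - j) - 1)^2 = (2 * b - of_nat d + 2 * complex_of_nat j - 1)^2"
    using j by (simp add: power2_eq_square algebra_simps)
  ultimately show ?thesis by (simp add: Odelta_def)
qed

lemma Oalpha_reflect: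
  assumes ev: "even d" and j: "j \<le> d"
  shows "Oalpha (- c) (- b) a d (d - j) = - Oalpha c b a d j"
proof -
  have om: "Oomega (- c) (- b) a d (Suc d - i) = Oomega c b a d i" if i: "i \<le> Suc d" for i
  proof -
    have "Ophi (- c) (- b) a d (Suc d - i) = Ophi b c a d i"
      using Ophi_reflect[OF ev, of "Suc d - i" c b a] i by simp
    also have "\<dots> = Ophi c b a d i" by (simp add: Ophi_def algebra_simps)
    finally have 1: "Ophi (- c) (- b) a d (Suc d - i) = Ophi c b a d i" .
    have 2: "(-1::complex)^(Suc d - i) = - ((-1)^i)" using ev i by (auto simp: uminus_power_if)
    have 3: "2 * (- b) - of_nat d + 2 * of_nat (Suc d - i) - 1 = - (2 * b - of_nat d + 2 * complex_of_nat i - 1)"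
      using i by (simp add: algebra_simps)
    show ?thesis by (simp only: Oomega_def 1 2 3 mult_minus_left minus_divide_divide)
  qed
  have "Oomega (- c) (- b) a d (d - j) = Oomega c b a d (Suc j)" using om[of "Suc j"] j by simp
  moreover have "Oomega (- c) (- b) a d (Suc (d - j)) = Oomega c b a d j" using om[of j] j by (simp add: Suc_diff_le)
  ultimately have "Oalpha (- c) (- b) a d (d - j) = Oth (- c) d (d - j) + Oomega c b a d (Suc j) - Oomega c b a d j"
    by (simp add: Oalpha_def)
  then show ?thesis using Oth_reflect[OF ev, of "d - j" c] j by (simp add: Oalpha_def)
qed

lemma nondeg_inj: "nondeg b d \<Longrightarrow> inj_on (Oth b d) {..d}"
  using Oth_neq by (intro linorder_inj_onI) auto

lemma bi_irreducible_cyc_aut: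
  assumes ev: "even d" and nd: "nondeg b d" and e: "e \<noteq> 0"
    and nz: "\<And>j. 1 \<le> j \<Longrightarrow> j \<le> d \<Longrightarrow> Odelta a b c d j \<noteq> 0"
  shows "bi_irreducible (twist (Omod d a b c) (cyc_aut e))"
  by (rule bi_irreducible_iso[OF bi_closed_Tmod bi_iso_cyc_aut[OF ev nd] bi_irreducible_Tmod])
    (use nondeg_inj[OF nd] e nz in \<open>auto simp: inj_on_def\<close>)

text \<open>The intermediate module is the \<open>neg_swap\<close> twist of O_d(-c,b,-a): it has the
  same b, hence the same X-eigenvalues -theta_j, and reflection turns it into O_d(-b,c,-a).\<close>

lemma bi_iso_cyc_aut_minus:
  assumes ev: "even d" and nd: "nondeg b d"
    and nz: "\<And>j. 1 \<le> j \<Longrightarrow> j \<le> d \<Longrightarrow> Odelta a b c d j \<noteq> 0"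
  shows "bi_iso (twist (Omod d a b c) (cyc_aut (-1))) (Omod d (- b) c (- a))"
proof -
  let ?T = "Tmod d (\<lambda>i. -1 * Oth b d i)
      (\<lambda>i. 2 * Oth b d i * Oalpha a b c d i - (2 * a * b - c * (of_nat d + 1)))
      (\<lambda>i. (-1)^i) (\<lambda>i. (-1)^i * Odelta a b c d i) (-1 * (2 * b * c - a * (of_nat d + 1)))"
  have nz': "Ophi (- c) b (- a) d j \<noteq> 0" if "1 \<le> j" "j \<le> d" for j
    using nz[OF that] Odelta_eq_0[of "- c" b "- a" d j] by (auto simp: Odelta_minus)
  have 1: "bi_iso (twist (Omod d a b c) (cyc_aut (-1))) ?T"
    by (rule bi_iso_sym[OF bi_closed_Tmod bi_iso_cyc_aut[OF ev nd]])
  have k: "-1 * (2 * b * c - a * (of_nat d + 1)) = 2 * (- c) * b - (- a) * (of_nat d + 1)"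
    by simp
  have 2: "bi_iso ?T (Tmod d (\<lambda>i. - Oth b d i) (\<lambda>i. - Oalpha (- c) b (- a) d i) (\<lambda>_. -1)
     (\<lambda>i. - Odelta (- c) b (- a) d i) (2 * (- c) * b - (- a) * (of_nat d + 1)))"
    unfolding k
    by (rule bi_iso_Tmod_rescale) (use Oalpha_minus[OF ev nd] in \<open>auto simp: Odelta_minus\<close>)
  show ?thesis
    using bi_iso_trans[OF 1 bi_iso_trans[OF 2 bi_iso_trans[OF bi_iso_neg_swap[OF ev nd, of "- c" "- a"] bi_iso_Omod_reflect[OF ev nz']]]]
    by simp
qed

text \<open>Now X has eigenvalues +theta_j, while a \<open>neg_swap\<close> twist always shows
  negated ones. Since -theta_j for -b is theta_(d-j) for b, the basis is reversed and compared with
  O_d(-c,-b,a), whose eigenbasis requires nondegeneracy of -b.\<close>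

lemma bi_iso_cyc_aut_plus:
  assumes ev: "even d" and nd: "nondeg b d" and nd': "nondeg (- b) d"
    and nz: "\<And>j. 1 \<le> j \<Longrightarrow> j \<le> d \<Longrightarrow> Odelta a b c d j \<noteq> 0"
  shows "bi_iso (twist (Omod d a b c) (cyc_aut 1)) (Omod d b c a)"
proof -
  let ?la = "2 * b * c - a * (of_nat d + 1)"
  let ?th = "\<lambda>i. 1 * Oth b d i" and ?p = "\<lambda>i. (-1::complex)^i" and ?r = "\<lambda>i. (-1)^i * Odelta a b c d i"
    and ?al = "\<lambda>i. 2 * Oth b d i * Oalpha a b c d i - (2 * a * b - c * (of_nat d + 1))"
  have dl: "Odelta (- c) (- b) a d j = Odelta a b c d (Suc d - j)" if "j \<le> Suc d" for j
    using Odelta_swap_reflect[OF ev, of "Suc d - j" c b a] that by simp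
  have nz': "Ophi (- c) (- b) a d j \<noteq> 0" if "1 \<le> j" "j \<le> d" for j
    using nz[of "Suc d - j"] that Odelta_eq_0[of "- c" "- b" a d j] by (auto simp: dl)
  have 1: "bi_iso (twist (Omod d a b c) (cyc_aut 1)) (Tmod d ?th ?al ?p ?r (1 * ?la))"
    by (rule bi_iso_sym[OF bi_closed_Tmod bi_iso_cyc_aut[OF ev nd]])
  note 2 = bi_iso_Tmod_reverse[of d ?th ?al ?p ?r "1 * ?la"]
  have k: "1 * ?la = 2 * (- c) * (- b) - a * (of_nat d + 1)"
    by simp
  have 3: "bi_iso (Tmod d (\<lambda>i. ?th (d - i)) (\<lambda>i. ?al (d - i)) (\<lambda>i. ?r (d + 1 - i)) (\<lambda>i. ?p (d + 1 - i)) (1 * ?la))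
    (Tmod d (\<lambda>i. - Oth (- b) d i) (\<lambda>i. - Oalpha (- c) (- b) a d i) (\<lambda>_. -1)
     (\<lambda>i. - Odelta (- c) (- b) a d i) (2 * (- c) * (- b) - a * (of_nat d + 1)))"
    unfolding k
  proof (rule bi_iso_Tmod_rescale)
    fix j assume j: "1 \<le> j" "j \<le> d"
    show "?r (d + 1 - j) * ?p (d + 1 - j) = - 1 * - Odelta (- c) (- b) a d j"
      using j by (simp add: dl mult.assoc[symmetric])
    show "?r (d + 1 - j) \<noteq> 0" using nz[of "d + 1 - j"] j by auto
  next
    fix j assume j: "j \<le> d"
    show "?th (d - j) = - Oth (- b) d j" using Oth_reflect[OF ev j, of b] by simp
    show "?al (d - j) = - Oalpha (- c) (- b) a d j"
      using Oalpha_swap[OF ev nd, of "d - j" a c] Oalpha_reflect[OF ev, of "d - j" c b a] j by simp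
  qed simp
  show ?thesis
    using bi_iso_trans[OF 1 bi_iso_trans[OF 2 bi_iso_trans[OF 3 bi_iso_trans[OF bi_iso_neg_swap[OF ev nd', of "- c" a] bi_iso_Omod_reflect[OF ev nz']]]]]
    by simp
qed

section \<open>Spinor-valued polynomials and the Dunkl Dirac operator\<close>

text \<open>The factor in T_i x_i^m = \<open>dunkl_coeff (k i) m\<close> x_i^(m-1).\<close>

definition dunkl_coeff :: "real \<Rightarrow> nat \<Rightarrow> complex" where
  "dunkl_coeff \<kappa> m = of_nat m + complex_of_real \<kappa> * (1 - (-1)^m)"

lemma dunkl_coeff_Suc: "dunkl_coeff \<kappa> (Suc m) = of_nat m + 1 + complex_of_real \<kappa> * (1 + (-1)^m)"
  by (simp add: dunkl_coeff_def)

lemmas op_defs = Tdunkl_def pauli_def Rop_def mulx_def ex_def incr_def decr_def vec_defs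

lemma Dirac_C0: "Dirac k f (C0, (a, b, c)) = dunkl_coeff (k 1) (Suc a) * f (C1, (Suc a, b, c))
    - \<i> * dunkl_coeff (k 2) (Suc b) * f (C1, (a, Suc b, c)) + dunkl_coeff (k 3) (Suc c) * f (C0, (a, b, Suc c))"
  by (simp add: Dirac_def op_defs dunkl_coeff_def algebra_simps)

lemma Dirac_C1: "Dirac k f (C1, (a, b, c)) = dunkl_coeff (k 1) (Suc a) * f (C0, (Suc a, b, c))
    + \<i> * dunkl_coeff (k 2) (Suc b) * f (C0, (a, Suc b, c)) - dunkl_coeff (k 3) (Suc c) * f (C1, (a, b, Suc c))"
  by (simp add: Dirac_def op_defs dunkl_coeff_def algebra_simps)

definition spin_flip :: "two \<Rightarrow> two" where
  "spin_flip s = (case s of C0 \<Rightarrow> C1 | C1 \<Rightarrow> C0)"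

definition spin_sign :: "two \<Rightarrow> complex" where
  "spin_sign s = (case s of C0 \<Rightarrow> 1 | C1 \<Rightarrow> -1)"

lemma ang_X: "ang k 1 2 3 f (s, (a, b, c)) =
    \<i> * (-1)^(b + c) * ((if c = 0 then 0 else dunkl_coeff (k 2) (Suc b) * f (spin_flip s, (a, Suc b, c - 1)))
        - (if b = 0 then 0 else dunkl_coeff (k 3) (Suc c) * f (spin_flip s, (a, b - 1, Suc c))))
    + ((-1)^(b + c) / 2 + complex_of_real (k 2) * (-1)^c + complex_of_real (k 3) * (-1)^b) * f (s, (a, b, c))"
  by (cases s; cases b; cases c) (simp_all add: ang_def Let_def op_defs dunkl_coeff_def spin_flip_def power_add algebra_simps)

lemma ang_Y: "ang k 2 3 1 f (s, (a, b, c)) =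
    spin_sign s * (-1)^(a + c) * ((if a = 0 then 0 else dunkl_coeff (k 3) (Suc c) * f (spin_flip s, (a - 1, b, Suc c)))
        - (if c = 0 then 0 else dunkl_coeff (k 1) (Suc a) * f (spin_flip s, (Suc a, b, c - 1))))
    + ((-1)^(a + c) / 2 + complex_of_real (k 3) * (-1)^a + complex_of_real (k 1) * (-1)^c) * f (s, (a, b, c))"
  by (cases s; cases a; cases c) (simp_all add: ang_def Let_def op_defs dunkl_coeff_def spin_flip_def spin_sign_def power_add algebra_simps)

lemma ang_Z: "ang k 3 1 2 f (s, (a, b, c)) =
    spin_sign s * \<i> * (-1)^(a + b) * ((if b = 0 then 0 else dunkl_coeff (k 1) (Suc a) * f (s, (Suc a, b - 1, c)))
        - (if a = 0 then 0 else dunkl_coeff (k 2) (Suc b) * f (s, (a - 1, Suc b, c))))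
    + ((-1)^(a + b) / 2 + complex_of_real (k 1) * (-1)^b + complex_of_real (k 2) * (-1)^a) * f (s, (a, b, c))"
  by (cases s; cases a; cases b) (simp_all add: ang_def Let_def op_defs dunkl_coeff_def spin_sign_def power_add algebra_simps)

text \<open>Once the parities of the two exponents that X moves are fixed, all reflections are signs
  and both sides agree coefficient by coefficient. Commuting with the Dirac operator makes its
  kernel stable.\<close>

lemma Dirac_ang_X: "Dirac k (ang k 1 2 3 f) (s, (a, b, c)) = ang k 1 2 3 (Dirac k f) (s, (a, b, c))"
  by (cases s; cases b; cases c; cases "even b"; cases "even c")
    (simp_all add: Dirac_C0 Dirac_C1 ang_X ang_X[unfolded One_nat_def] spin_flip_def dunkl_coeff_Suc[of "k 2"] dunkl_coeff_Suc[of "k 3"] field_simps)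

lemma Dirac_ang_Y: "Dirac k (ang k 2 3 1 f) (s, (a, b, c)) = ang k 2 3 1 (Dirac k f) (s, (a, b, c))"
  by (cases s; cases a; cases c; cases "even a"; cases "even c")
    (simp_all add: Dirac_C0 Dirac_C1 ang_Y ang_Y[unfolded One_nat_def] spin_flip_def spin_sign_def dunkl_coeff_Suc[of "k 1"] dunkl_coeff_Suc[of "k (Suc 0)"] dunkl_coeff_Suc[of "k 3"] field_simps)

lemma Dirac_ang_Z: "Dirac k (ang k 3 1 2 f) (s, (a, b, c)) = ang k 3 1 2 (Dirac k f) (s, (a, b, c))"
  by (cases s; cases a; cases b; cases "even a"; cases "even b")
    (simp_all add: Dirac_C0 Dirac_C1 ang_Z ang_Z[unfolded One_nat_def] spin_sign_def dunkl_coeff_Suc[of "k 1"] dunkl_coeff_Suc[of "k (Suc 0)"] dunkl_coeff_Suc[of "k 2"] field_simps)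

lemma vec_eqI: "(\<And>s a b c. f (s, (a, b, c)) = g (s, (a, b, c))) \<Longrightarrow> f = (g :: idx vec)"
  by (rule ext) (metis prod.exhaust)

lemma ang_zero: "ang k i p q vzero = vzero"
  by (rule vec_eqI) (auto simp: ang_def Let_def op_defs split: two.split)

lemma Mn_iff: "f \<in> Mn k n \<longleftrightarrow> (\<forall>s a b c. a + b + c \<noteq> n \<longrightarrow> f (s, (a, b, c)) = 0) \<and>
    (\<forall>s a b c. Dirac k f (s, (a, b, c)) = 0)"
  by (auto simp: Mn_def Pn_def vzero_def fun_eq_iff)

lemma act_Mmod: "act (Mmod k n) = case_gen (ang k 1 2 3) (ang k 2 3 1) (ang k 3 1 2)"
  by (auto simp: Mmod_def fun_eq_iff split: gen.split)

lemma act_Mmod_Mn: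
  assumes "f \<in> Mn k n"
  shows "act (Mmod k n) g f \<in> Mn k n"
proof -
  have D: "Dirac k f = vzero" using assms by (simp add: Mn_def)
  have P: "f (s, (a, b, c)) = 0" if "a + b + c \<noteq> n" for s a b c
    using assms that by (auto simp: Mn_iff)
  show ?thesis
  proof (cases g)
    case GX
    show ?thesis
      unfolding GX act_Mmod gen.case Mn_iff Dirac_ang_X D ang_zero ang_X by (auto simp: vzero_def P)
  next
    case GY
    show ?thesis
      unfolding GY act_Mmod gen.case Mn_iff Dirac_ang_Y D ang_zero ang_Y by (auto simp: vzero_def P)
  next
    case GZ
    show ?thesis
      unfolding GZ act_Mmod gen.case Mn_iff Dirac_ang_Z D ang_zero ang_Z by (auto simp: vzero_def P)
  qed
qed

text \<open>The Dirac equation expresses the coefficients at x_2^(b+1) through those at x_2^b with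
  exponent a or a + 1 of x_1. The exponent leaves the range only at a + 1 = N, where T_1 or the
  degree gives zero. N = n + 1 yields uniqueness of the extension; N = t_1 propagates vanishing
  below t_1.\<close>

lemma Mn_unique:
  assumes f: "f \<in> Mn k n" and nz: "\<And>m. 1 \<le> m \<Longrightarrow> m \<le> n \<Longrightarrow> dunkl_coeff (k 2) m \<noteq> 0"
    and N: "dunkl_coeff (k 1) N = 0 \<or> n < N"
    and z: "\<And>s i. i < N \<Longrightarrow> f (s, (i, 0, n - i)) = 0"
  shows "a < N \<Longrightarrow> f (s, (a, b, c)) = 0"
proof (induction b arbitrary: s a c)
  case 0
  show ?case
  proof (cases "a + c = n")
    case True
    then have "c = n - a" by simp
    then show ?thesis using z 0 by simp
  qed (use f in \<open>auto simp: Mn_iff\<close>)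
next
  case (Suc b)
  show ?case
  proof (cases "a + Suc b + c = n")
    case True
    have D: "Dirac k f (t, (a, b, c)) = 0" for t using f by (auto simp: Mn_iff)
    have 1: "dunkl_coeff (k 1) (Suc a) * f (t, (Suc a, b, c)) = 0" for t
    proof (cases "Suc a < N")
      case False
      then have "Suc a = N" using Suc.prems by simp
      then show ?thesis using N f by (auto simp: Mn_iff)
    qed (simp add: Suc.IH)
    have "dunkl_coeff (k 2) (Suc b) * f (C1, (a, Suc b, c)) = 0"
      using D[of C0] unfolding Dirac_C0 1 Suc.IH[OF Suc.prems] by simp
    moreover have "dunkl_coeff (k 2) (Suc b) * f (C0, (a, Suc b, c)) = 0"
      using D[of C1] unfolding Dirac_C1 1 Suc.IH[OF Suc.prems] by simp
    ultimately have "dunkl_coeff (k 2) (Suc b) * f (s, (a, Suc b, c)) = 0" by (cases s) auto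
    then show ?thesis using nz[of "Suc b"] True by simp
  qed (use f in \<open>auto simp: Mn_iff\<close>)
qed

text \<open>Solves the Dirac equation for the coefficient of $x_2^{b+1}$.\<close>
primrec ck_extension :: "(nat \<Rightarrow> real) \<Rightarrow> (two \<Rightarrow> nat \<Rightarrow> complex) \<Rightarrow> nat \<Rightarrow> two \<Rightarrow> nat \<Rightarrow> nat \<Rightarrow> complex" where
  "ck_extension k u 0 s a c = u s a"
| "ck_extension k u (Suc b) s a c = \<i> / dunkl_coeff (k 2) (Suc b) *
     (spin_sign s * dunkl_coeff (k 1) (Suc a) * ck_extension k u b s (Suc a) c - dunkl_coeff (k 3) (Suc c) * ck_extension k u b (spin_flip s) a (Suc c))"

lemma Mn_exists:
  assumes nz: "\<And>m. 1 \<le> m \<Longrightarrow> m \<le> n \<Longrightarrow> dunkl_coeff (k 2) m \<noteq> 0"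
  shows "\<exists>f\<in>Mn k n. \<forall>s i. i \<le> n \<longrightarrow> f (s, (i, 0, n - i)) = u s i"
proof -
  let ?f = "\<lambda>(s, (a, b, c)). if a + b + c = n then ck_extension k u b s a c else 0"
  have "?f \<in> Mn k n" unfolding Mn_iff
  proof (intro conjI allI impI)
    fix s a b c
    show "Dirac k ?f (s, (a, b, c)) = 0"
      using nz[of "Suc b"]
      by (cases s) (auto simp: Dirac_C0 Dirac_C1 spin_sign_def spin_flip_def field_simps)
  qed auto
  then show ?thesis by (intro bexI[of _ ?f]) auto
qed

text \<open>Up to a factor, the projection of the restriction to $x_2 = 0$ onto the $\epsilon$-eigenspace of $e_2$.\<close>
definition spinor_coeff :: "complex \<Rightarrow> nat \<Rightarrow> idx vec \<Rightarrow> nat \<Rightarrow> complex" where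
  "spinor_coeff \<epsilon> n f i = f (C0, (i, 0, n - i)) - \<epsilon> * \<i> * f (C1, (i, 0, n - i))"

context
  fixes k :: "nat \<Rightarrow> real" and n :: nat and f :: "idx vec" and \<epsilon> :: complex
  assumes f: "f \<in> Mn k n" and \<epsilon>: "\<epsilon> * \<epsilon> = 1"
begin

lemma eps_mult: "\<epsilon> * (\<epsilon> * x) = x" "\<epsilon>^2 = 1"
  by (simp_all add: \<epsilon> mult.assoc[symmetric] power2_eq_square)

text \<open>The Dirac equation at x_2 = 0, solved for the x_2-linear coefficients. It eliminates T_2
  from X and Z, whose other terms carry a factor x_2 and vanish there; Y contains neither x_2 nor
  T_2.\<close>

lemma Dirac_eqs:
  "\<i> * dunkl_coeff (k 2) 1 * f (C1, (a, 1, c)) = dunkl_coeff (k 1) (Suc a) * f (C1, (Suc a, 0, c)) + dunkl_coeff (k 3) (Suc c) * f (C0, (a, 0, Suc c))"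
  "\<i> * dunkl_coeff (k 2) 1 * f (C0, (a, 1, c)) = dunkl_coeff (k 3) (Suc c) * f (C1, (a, 0, Suc c)) - dunkl_coeff (k 1) (Suc a) * f (C0, (Suc a, 0, c))"
proof -
  have "Dirac k f (s, (a, 0, c)) = 0" for s using f by (auto simp: Mn_iff)
  from this[of C0] this[of C1] show
    "\<i> * dunkl_coeff (k 2) 1 * f (C1, (a, 1, c)) = dunkl_coeff (k 1) (Suc a) * f (C1, (Suc a, 0, c)) + dunkl_coeff (k 3) (Suc c) * f (C0, (a, 0, Suc c))"
    "\<i> * dunkl_coeff (k 2) 1 * f (C0, (a, 1, c)) = dunkl_coeff (k 3) (Suc c) * f (C1, (a, 0, Suc c)) - dunkl_coeff (k 1) (Suc a) * f (C0, (Suc a, 0, c))"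
    by (simp_all add: Dirac_C0 Dirac_C1) (simp_all add: algebra_simps eq_neg_iff_add_eq_0)
qed

lemma spinor_coeff_Z:
  assumes "i \<le> n"
  shows "spinor_coeff \<epsilon> n (ang k 3 1 2 f) i = (-1)^i * (of_nat i + complex_of_real (k 1) + complex_of_real (k 2) + 1/2) * spinor_coeff \<epsilon> n f i
    - (if i = 0 then 0 else \<epsilon> * \<i> * (-1)^i * dunkl_coeff (k 3) (Suc (n - i)) * spinor_coeff \<epsilon> n f (i - 1))"
proof (cases i)
  case 0
  then show ?thesis unfolding spinor_coeff_def ang_Z by (simp add: field_simps)
next
  case (Suc a)
  have n: "n - a = Suc (n - Suc a)" using assms Suc by simp
  have H: "spinor_coeff \<epsilon> n (ang k 3 1 2 f) i = (-1)^i * (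
      - (\<i> * dunkl_coeff (k 2) 1 * f (C0, (a, 1, n - Suc a))) - \<epsilon> * \<i> * (\<i> * dunkl_coeff (k 2) 1 * f (C1, (a, 1, n - Suc a))))
     + ((-1)^i / 2 + complex_of_real (k 1) + complex_of_real (k 2) * (-1)^i) * spinor_coeff \<epsilon> n f i"
    unfolding spinor_coeff_def ang_Z Suc by (simp add: spin_sign_def field_simps)
  show ?thesis unfolding H Dirac_eqs
    by (cases "even a") (simp_all add: spinor_coeff_def Suc n dunkl_coeff_def field_simps eps_mult)
qed

lemma spinor_coeff_X:
  assumes "i \<le> n" "odd n"
  shows "spinor_coeff \<epsilon> n (ang k 1 2 3 f) i = - ((-1)^i) * (of_nat (n - i) + complex_of_real (k 2) + complex_of_real (k 3) + 1/2) * spinor_coeff \<epsilon> n f i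
    - (if i = n then 0 else \<epsilon> * \<i> * (-1)^i * dunkl_coeff (k 1) (Suc i) * spinor_coeff \<epsilon> n f (Suc i))"
proof (cases "n - i")
  case 0
  then have "i = n" using assms by simp
  then show ?thesis unfolding spinor_coeff_def ang_X using assms(2) by (simp add: field_simps)
next
  case (Suc c)
  \<comment> \<open>For odd n the parities of i and c = n - i - 1 agree, so the reflection in x_3
    gives the same sign as (-1)^i.\<close>
  have "n = i + Suc c" using Suc assms(1) by simp
  then have "even i \<longleftrightarrow> even c" using assms(2) by simp
  then have p: "(-1::complex)^i = (-1)^c" by (auto simp: uminus_power_if)
  have c: "n - Suc i = c" and ne: "i \<noteq> n" using Suc by auto
  have H: "spinor_coeff \<epsilon> n (ang k 1 2 3 f) i = - ((-1)^c) * (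
      (\<i> * dunkl_coeff (k 2) 1 * f (C1, (i, 1, c))) - \<epsilon> * \<i> * (\<i> * dunkl_coeff (k 2) 1 * f (C0, (i, 1, c))))
     + (- ((-1)^c) / 2 - complex_of_real (k 2) * (-1)^c + complex_of_real (k 3)) * spinor_coeff \<epsilon> n f i"
    unfolding spinor_coeff_def ang_X Suc using p by (simp add: spin_flip_def algebra_simps)
  have aux: "- s * (b1 * B1 + b3 * A0 - e * I * (b3 * A1 - b1 * B0)) + (- s / 2 - y * s + z) * (A0 - e * I * A1)
      = - s * (N + y + z + 1 / 2) * (A0 - e * I * A1) - e * I * s * b1 * (B0 - e * I * B1)"
    if "s * s = 1" "e * e = 1" "I * I = -1" "b3 = N + z * (1 + s)"
    for s e I b1 b3 A0 A1 B0 B1 N y z :: complex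
    using that by algebra
  have s: "(-1)^c * (-1)^c = (1::complex)" by (simp add: power_mult_distrib[symmetric])
  have b: "dunkl_coeff (k 3) (Suc c) = of_nat (Suc c) + complex_of_real (k 3) * (1 + (-1)^c)" by (simp add: dunkl_coeff_def)
  show ?thesis
    unfolding H Dirac_eqs p unfolding spinor_coeff_def Suc c using ne aux[OF s \<epsilon> i_squared b] by simp
qed

lemma spinor_coeff_Y:
  assumes "i \<le> n" "odd n"
  shows "spinor_coeff \<epsilon> n (ang k 2 3 1 f) i = (- 1/2 + (-1)^i * (complex_of_real (k 3) - complex_of_real (k 1))) * spinor_coeff \<epsilon> n f i
    - (if i = 0 then 0 else \<epsilon> * \<i> * dunkl_coeff (k 3) (Suc (n - i)) * spinor_coeff \<epsilon> n f (i - 1))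
    + (if i = n then 0 else \<epsilon> * \<i> * dunkl_coeff (k 1) (Suc i) * spinor_coeff \<epsilon> n f (Suc i))"
proof -
  have p: "(-1::complex)^(i + (n - i)) = -1" using assms by simp
  have p': "(-1::complex)^(n - i) = - ((-1)^i)" using assms by (auto simp: uminus_power_if)
  have n: "n - (i - 1) = Suc (n - i)" if "i \<noteq> 0" using that assms by simp
  define L where "L t = (if i = 0 then 0 else dunkl_coeff (k 3) (Suc (n - i)) * f (t, (i - 1, 0, Suc (n - i))))" for t
  define M where "M t = (if n - i = 0 then 0 else dunkl_coeff (k 1) (Suc i) * f (t, (Suc i, 0, n - i - 1)))" for t
  define D where "D = - 1/2 + (-1)^i * (complex_of_real (k 3) - complex_of_real (k 1))"
  have "(-1)^(i + (n - i)) / 2 + complex_of_real (k 3) * (-1)^i + complex_of_real (k 1) * (-1)^(n - i) = D"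
    unfolding p p' D_def by (simp add: algebra_simps)
  then have 1: "spinor_coeff \<epsilon> n (ang k 2 3 1 f) i = - (L C1 - M C1) + D * f (C0, (i, 0, n - i))
      - \<epsilon> * \<i> * (L C0 - M C0 + D * f (C1, (i, 0, n - i)))"
    unfolding spinor_coeff_def ang_Y p by (simp only: L_def M_def) (simp add: spin_flip_def spin_sign_def)
  have 2: "(if i = 0 then 0 else \<epsilon> * \<i> * dunkl_coeff (k 3) (Suc (n - i)) * spinor_coeff \<epsilon> n f (i - 1))
      = \<epsilon> * \<i> * (L C0 - \<epsilon> * \<i> * L C1)"
    using n by (simp add: spinor_coeff_def L_def algebra_simps)
  have 3: "(if i = n then 0 else \<epsilon> * \<i> * dunkl_coeff (k 1) (Suc i) * spinor_coeff \<epsilon> n f (Suc i))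
      = \<epsilon> * \<i> * (M C0 - \<epsilon> * \<i> * M C1)"
    using assms(1) by (auto simp: spinor_coeff_def M_def algebra_simps)
  have aux: "- (L1 - M1) + D * u0 - e * I * (L0 - M0 + D * u1)
      = D * (u0 - e * I * u1) - e * I * (L0 - e * I * L1) + e * I * (M0 - e * I * M1)"
    if "e * e = 1" "I * I = -1" for e I L0 L1 M0 M1 D u0 u1 :: complex
    using that by algebra
  show ?thesis unfolding 1 2 3 D_def[symmetric] unfolding spinor_coeff_def by (rule aux[OF \<epsilon> i_squared])
qed

end

section \<open>From monogenic polynomials to $O_d(a,b,c)$\<close>

text \<open>The entry of Z from exponent lo + h - 1 to lo + h, without the common sign (-1)^lo.
  Dividing by the product of these entries makes the subdiagonal of Z constant.\<close>

definition raise_coeff :: "(nat \<Rightarrow> real) \<Rightarrow> complex \<Rightarrow> nat \<Rightarrow> nat \<Rightarrow> nat \<Rightarrow> complex" where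
  "raise_coeff k \<epsilon> n lo h = - (\<epsilon> * \<i>) * (-1)^h * dunkl_coeff (k 3) (Suc n - (lo + h))"

definition spinor_scale :: "(nat \<Rightarrow> real) \<Rightarrow> complex \<Rightarrow> nat \<Rightarrow> nat \<Rightarrow> nat \<Rightarrow> complex" where
  "spinor_scale k \<epsilon> n lo m = (\<Prod>h\<in>{1..m}. 1 / raise_coeff k \<epsilon> n lo h)"

definition spinor_map :: "(nat \<Rightarrow> real) \<Rightarrow> nat \<Rightarrow> nat \<Rightarrow> nat \<Rightarrow> complex \<Rightarrow> idx vec \<Rightarrow> nat vec" where
  "spinor_map k n lo d \<epsilon> f m = (if m \<le> d then spinor_scale k \<epsilon> n lo m * spinor_coeff \<epsilon> n f (lo + m) else 0)"

lemma spinor_map_finvec: "spinor_map k n lo d \<epsilon> f \<in> finvec d"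
  by (simp add: spinor_map_def finvec_def)

lemma spinor_coeff_linear:
  "spinor_coeff \<epsilon> n (vadd f g) i = spinor_coeff \<epsilon> n f i + spinor_coeff \<epsilon> n g i"
  "spinor_coeff \<epsilon> n (scal x f) i = x * spinor_coeff \<epsilon> n f i"
  by (simp_all add: spinor_coeff_def vec_defs algebra_simps)

lemma spinor_map_linear:
  "spinor_map k n lo d \<epsilon> (vadd f g) = vadd (spinor_map k n lo d \<epsilon> f) (spinor_map k n lo d \<epsilon> g)"
  "spinor_map k n lo d \<epsilon> (scal x f) = scal x (spinor_map k n lo d \<epsilon> f)"
  by (simp_all add: spinor_map_def spinor_coeff_linear fun_eq_iff) (simp_all add: vadd_def scal_def spinor_map_def algebra_simps)

lemma spinor_components:
  "f (C0, (i, 0, n - i)) = (spinor_coeff 1 n f i + spinor_coeff (-1) n f i) / 2"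
  "f (C1, (i, 0, n - i)) = \<i> * (spinor_coeff 1 n f i - spinor_coeff (-1) n f i) / 2"
  by (simp_all add: spinor_coeff_def algebra_simps)

text \<open>The window of $x_1$-exponents is $lo, \dots, lo + d$.\<close>
locale spinor_model =
  fixes k :: "nat \<Rightarrow> real" and n lo d :: nat
  assumes odd_n: "odd n" and lo_d: "lo + d \<le> n" and even_d: "even d"
    and nz2: "\<And>m. 1 \<le> m \<Longrightarrow> m \<le> n \<Longrightarrow> dunkl_coeff (k 2) m \<noteq> 0"
    and nz3: "\<And>m. 1 \<le> m \<Longrightarrow> m \<le> n \<Longrightarrow> dunkl_coeff (k 3) m \<noteq> 0"
    and high: "lo + d = n \<or> dunkl_coeff (k 1) (Suc (lo + d)) = 0"
begin

lemma raise_coeff_nonzero: "\<epsilon> \<noteq> 0 \<Longrightarrow> 1 \<le> h \<Longrightarrow> h \<le> d \<Longrightarrow> raise_coeff k \<epsilon> n lo h \<noteq> 0"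
  using lo_d nz3[of "Suc n - (lo + h)"] by (simp add: raise_coeff_def)

lemma spinor_scale_nonzero: "\<epsilon> \<noteq> 0 \<Longrightarrow> m \<le> d \<Longrightarrow> spinor_scale k \<epsilon> n lo m \<noteq> 0"
  using raise_coeff_nonzero by (simp add: spinor_scale_def)

lemma spinor_scale_Suc:
  assumes "\<epsilon> \<noteq> 0" "Suc m \<le> d"
  shows "spinor_scale k \<epsilon> n lo m = spinor_scale k \<epsilon> n lo (Suc m) * (\<epsilon> * \<i> * (-1)^m * dunkl_coeff (k 3) (n - (lo + m)))"
proof -
  have "raise_coeff k \<epsilon> n lo (Suc m) = \<epsilon> * \<i> * (-1)^m * dunkl_coeff (k 3) (n - (lo + m))"
    by (simp add: raise_coeff_def)
  then show ?thesis using raise_coeff_nonzero[OF assms(1), of "Suc m"] assms(2) by (simp add: spinor_scale_def)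
qed

text \<open>The eigenvalue of e_2 enters only through the scaling, so both components map to the
  same module; hence the two copies.\<close>

definition spinor_pair :: "idx vec \<Rightarrow> (nat + nat) vec" where
  "spinor_pair f = case_sum (spinor_map k n lo d 1 f) (spinor_map k n lo d (-1) f)"

lemma spinor_pair_linear: "spinor_pair (vadd f g) = vadd (spinor_pair f) (spinor_pair g)" "spinor_pair (scal x f) = scal x (spinor_pair f)"
  by (auto simp: spinor_pair_def spinor_map_linear fun_eq_iff split: sum.split) (auto simp: vec_defs)

lemma spinor_pair_eqD:
  assumes "spinor_pair f = spinor_pair g" "lo \<le> i" "i \<le> lo + d"
  shows "f (s, (i, 0, n - i)) = g (s, (i, 0, n - i))"
proof -
  obtain m where m: "i = lo + m" "m \<le> d" using assms(2,3) by (metis le_iff_add nat_add_left_cancel_le)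
  have "spinor_coeff \<epsilon> n f i = spinor_coeff \<epsilon> n g i" if "\<epsilon> = 1 \<or> \<epsilon> = -1" for \<epsilon>
  proof -
    have "spinor_map k n lo d \<epsilon> f m = spinor_map k n lo d \<epsilon> g m"
      using fun_cong[OF assms(1), of "Inl m"] fun_cong[OF assms(1), of "Inr m"] that
      by (auto simp: spinor_pair_def)
    then show ?thesis using m spinor_scale_nonzero[of \<epsilon> m] that by (auto simp: spinor_map_def)
  qed
  then have "spinor_coeff 1 n f i = spinor_coeff 1 n g i" "spinor_coeff (-1) n f i = spinor_coeff (-1) n g i" by simp_all
  then show ?thesis by (cases s) (simp_all only: spinor_components)
qed

lemma spinor_pair_surj:
  assumes "w \<circ> Inl \<in> finvec d" "w \<circ> Inr \<in> finvec d"
  shows "\<exists>f\<in>Mn k n. spinor_pair f = w \<and> (\<forall>s i. i \<le> n \<longrightarrow> i < lo \<or> lo + d < i \<longrightarrow> f (s, (i, 0, n - i)) = 0)"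
proof -
  define p where "p i = w (Inl (i - lo)) / spinor_scale k 1 n lo (i - lo)" for i
  define q where "q i = w (Inr (i - lo)) / spinor_scale k (-1) n lo (i - lo)" for i
  \<comment> \<open>The inverse of the two eigenspace projections inside the window, and zero
    outside it; \<open>Mn_exists\<close> extends this slice to a kernel element.\<close>
  define u where "u s i = (if lo \<le> i \<and> i \<le> lo + d
    then (case s of C0 \<Rightarrow> (p i + q i) / 2 | C1 \<Rightarrow> \<i> * (p i - q i) / 2) else 0)" for s i
  obtain f where f: "f \<in> Mn k n" "\<And>s i. i \<le> n \<Longrightarrow> f (s, (i, 0, n - i)) = u s i"
    using Mn_exists[of n k u] nz2 by blast
  have g: "spinor_coeff 1 n f (lo + m) = p (lo + m)" "spinor_coeff (-1) n f (lo + m) = q (lo + m)" if "m \<le> d" for m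
  proof -
    have l: "lo + m \<le> n" using that lo_d by simp
    show "spinor_coeff 1 n f (lo + m) = p (lo + m)" "spinor_coeff (-1) n f (lo + m) = q (lo + m)"
      unfolding spinor_coeff_def f(2)[OF l] using that by (simp_all add: u_def field_simps)
  qed
  have "spinor_pair f x = w x" for x
  proof (cases x)
    case (Inl m)
    then show ?thesis using g[of m] spinor_scale_nonzero[of 1 m] assms by (auto simp: spinor_pair_def spinor_map_def p_def finvec_def)
  next
    case (Inr m)
    then show ?thesis using g[of m] spinor_scale_nonzero[of "-1" m] assms by (auto simp: spinor_pair_def spinor_map_def q_def finvec_def)
  qed
  then have "spinor_pair f = w" by auto
  moreover have "\<forall>s i. i \<le> n \<longrightarrow> i < lo \<or> lo + d < i \<longrightarrow> f (s, (i, 0, n - i)) = 0"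
    using f(2) by (auto simp: u_def)
  ultimately show ?thesis using f(1) by blast
qed

text \<open>Matching with O_d entry by entry determines the parameters: a from the diagonal of Z, b
  from that of X, c from that of Y, and phi from the products across each edge. The sign (-1)^(lo+m)
  splits as e (-1)^m, so X and Z acquire the factor e and Y does not. Nothing enters the window from
  above, by the locale assumption \<open>high\<close>; that nothing enters from below is the
  hypothesis \<open>low\<close> for Y and Z.\<close>

context
  fixes a b c e :: complex
  assumes e: "e = (-1)^lo"
    and A: "\<And>m. m \<le> d \<Longrightarrow> Oth a d m = (-1)^m * (of_nat (lo + m) + complex_of_real (k 1) + complex_of_real (k 2) + 1/2)"
    and B: "\<And>m. m \<le> d \<Longrightarrow> Oth b d m = - ((-1)^m) * (of_nat (n - (lo + m)) + complex_of_real (k 2) + complex_of_real (k 3) + 1/2)"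
    and C: "\<And>m. Suc m \<le> d \<Longrightarrow> Ophi a b c d (Suc m) = dunkl_coeff (k 1) (Suc (lo + m)) * dunkl_coeff (k 3) (n - (lo + m))"
    and Z: "c + (of_nat d + 1) / 2 = e * (complex_of_real (k 3) - complex_of_real (k 1))"
begin

lemma spinor_map_Z:
  assumes f: "f \<in> Mn k n" and \<epsilon>: "\<epsilon> * \<epsilon> = 1" and low: "lo = 0 \<or> spinor_coeff \<epsilon> n f (lo - 1) = 0"
  shows "spinor_map k n lo d \<epsilon> (ang k 3 1 2 f) = scal e (OX a d (spinor_map k n lo d \<epsilon> f))"
proof
  fix m
  have e0: "\<epsilon> \<noteq> 0" using \<epsilon> by auto
  show "spinor_map k n lo d \<epsilon> (ang k 3 1 2 f) m = scal e (OX a d (spinor_map k n lo d \<epsilon> f)) m"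
  proof (cases "m \<le> d")
    case True
    then have l: "lo + m \<le> n" using lo_d by simp
    let ?s = "spinor_scale k \<epsilon> n lo" and ?g = "spinor_coeff \<epsilon> n f"
    have dg: "(-1)^(lo + m) * (of_nat (lo + m) + complex_of_real (k 1) + complex_of_real (k 2) + 1/2) = e * Oth a d m"
      unfolding A[OF True] e by (simp add: power_add)
    have lower: "?s m * (if lo + m = 0 then 0 else \<epsilon> * \<i> * (-1)^(lo + m) * dunkl_coeff (k 3) (Suc (n - (lo + m))) * ?g (lo + m - 1))
       = (if m = 0 then 0 else - e * (?s (m - 1) * ?g (lo + m - 1)))"
    proof (cases m)
      case 0 then show ?thesis using low by auto
    next
      case (Suc j)
      then have s: "Suc (n - (lo + Suc j)) = n - (lo + j)" "Suc j \<le> d" using l True by auto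
      show ?thesis using spinor_scale_Suc[OF e0 s(2)] unfolding Suc s(1) by (simp add: e power_add algebra_simps)
    qed
    have "spinor_map k n lo d \<epsilon> (ang k 3 1 2 f) m = ?s m * spinor_coeff \<epsilon> n (ang k 3 1 2 f) (lo + m)"
      using True by (simp add: spinor_map_def)
    also have "\<dots> = e * Oth a d m * (?s m * ?g (lo + m)) - (if m = 0 then 0 else - e * (?s (m - 1) * ?g (lo + m - 1)))"
      unfolding spinor_coeff_Z[OF f \<epsilon> l] dg lower[symmetric] by (simp only: right_diff_distrib mult_ac)
    also have "\<dots> = scal e (OX a d (spinor_map k n lo d \<epsilon> f)) m"
      using True by (auto simp: OX_tri spinor_map_def tri_def scal_def algebra_simps)
    finally show ?thesis .
  qed (simp add: spinor_map_def OX_tri tri_def scal_def)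
qed

lemma spinor_map_X:
  assumes f: "f \<in> Mn k n" and \<epsilon>: "\<epsilon> * \<epsilon> = 1"
  shows "spinor_map k n lo d \<epsilon> (ang k 1 2 3 f) = scal e (OY a b c d (spinor_map k n lo d \<epsilon> f))"
proof
  fix m
  have e0: "\<epsilon> \<noteq> 0" using \<epsilon> by auto
  have sq: "\<epsilon> * (\<epsilon> * x) = x" "(-1)^j * ((-1)^j * x) = x" for x j
    by (simp_all add: \<epsilon> mult.assoc[symmetric] power_mult_distrib[symmetric])
  show "spinor_map k n lo d \<epsilon> (ang k 1 2 3 f) m = scal e (OY a b c d (spinor_map k n lo d \<epsilon> f)) m"
  proof (cases "m \<le> d")
    case True
    then have l: "lo + m \<le> n" using lo_d by simp
    let ?s = "spinor_scale k \<epsilon> n lo" and ?g = "spinor_coeff \<epsilon> n f"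
    have dg: "- ((-1)^(lo + m)) * (of_nat (n - (lo + m)) + complex_of_real (k 2) + complex_of_real (k 3) + 1/2) = e * Oth b d m"
      unfolding B[OF True] e by (simp add: power_add)
    have upper: "?s m * (if lo + m = n then 0 else \<epsilon> * \<i> * (-1)^(lo + m) * dunkl_coeff (k 1) (Suc (lo + m)) * ?g (Suc (lo + m)))
       = (if m < d then - e * Ophi a b c d (Suc m) * (?s (Suc m) * ?g (Suc (lo + m))) else 0)"
    proof (cases "m = d")
      case m: True
      then show ?thesis using high by auto
    next
      case False
      then have s: "Suc m \<le> d" "lo + m \<noteq> n" using True lo_d by auto
      then show ?thesis using spinor_scale_Suc[OF e0 s(1)] C[OF s(1)] by (simp add: e power_add algebra_simps sq)
    qed
    have "spinor_map k n lo d \<epsilon> (ang k 1 2 3 f) m = ?s m * spinor_coeff \<epsilon> n (ang k 1 2 3 f) (lo + m)"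
      using True by (simp add: spinor_map_def)
    also have "\<dots> = e * Oth b d m * (?s m * ?g (lo + m))
       - (if m < d then - e * Ophi a b c d (Suc m) * (?s (Suc m) * ?g (Suc (lo + m))) else 0)"
      unfolding spinor_coeff_X[OF f \<epsilon> l odd_n] dg upper[symmetric] by (simp only: right_diff_distrib mult_ac)
    also have "\<dots> = scal e (OY a b c d (spinor_map k n lo d \<epsilon> f)) m"
      using True by (auto simp: OY_tri spinor_map_def tri_def scal_def algebra_simps)
    finally show ?thesis .
  qed (simp add: spinor_map_def OY_tri tri_def scal_def)
qed

lemma spinor_map_Y:
  assumes f: "f \<in> Mn k n" and \<epsilon>: "\<epsilon> * \<epsilon> = 1" and low: "lo = 0 \<or> spinor_coeff \<epsilon> n f (lo - 1) = 0"
  shows "spinor_map k n lo d \<epsilon> (ang k 2 3 1 f) = OZ a b c d (spinor_map k n lo d \<epsilon> f)"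
proof
  fix m
  have e0: "\<epsilon> \<noteq> 0" using \<epsilon> by auto
  have sq: "\<epsilon> * (\<epsilon> * x) = x" "(-1)^j * ((-1)^j * x) = x" for x j
    by (simp_all add: \<epsilon> mult.assoc[symmetric] power_mult_distrib[symmetric])
  show "spinor_map k n lo d \<epsilon> (ang k 2 3 1 f) m = OZ a b c d (spinor_map k n lo d \<epsilon> f) m"
  proof (cases "m \<le> d")
    case True
    then have l: "lo + m \<le> n" using lo_d by simp
    let ?s = "spinor_scale k \<epsilon> n lo" and ?g = "spinor_coeff \<epsilon> n f"
    have dg: "- 1/2 + (-1)^(lo + m) * (complex_of_real (k 3) - complex_of_real (k 1)) = Ozeta c d m"
      unfolding Ozeta_def Z e by (simp add: power_add algebra_simps)
    have lower: "?s m * (if lo + m = 0 then 0 else \<epsilon> * \<i> * dunkl_coeff (k 3) (Suc (n - (lo + m))) * ?g (lo + m - 1))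
       = (if m = 0 then 0 else - ((-1)^m) * (?s (m - 1) * ?g (lo + m - 1)))"
    proof (cases m)
      case 0 then show ?thesis using low by auto
    next
      case (Suc j)
      then have s: "Suc (n - (lo + Suc j)) = n - (lo + j)" "Suc j \<le> d" using l True by auto
      show ?thesis using spinor_scale_Suc[OF e0 s(2)] unfolding Suc s(1) by (simp add: algebra_simps sq)
    qed
    have upper: "?s m * (if lo + m = n then 0 else \<epsilon> * \<i> * dunkl_coeff (k 1) (Suc (lo + m)) * ?g (Suc (lo + m)))
       = (if m < d then - ((-1)^m) * Ophi a b c d (Suc m) * (?s (Suc m) * ?g (Suc (lo + m))) else 0)"
    proof (cases "m = d")
      case m: True
      then show ?thesis using high by auto
    next
      case False
      then have s: "Suc m \<le> d" "lo + m \<noteq> n" using True lo_d by auto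
      then show ?thesis using spinor_scale_Suc[OF e0 s(1)] C[OF s(1)] by (simp add: algebra_simps sq)
    qed
    have "spinor_map k n lo d \<epsilon> (ang k 2 3 1 f) m = ?s m * spinor_coeff \<epsilon> n (ang k 2 3 1 f) (lo + m)"
      using True by (simp add: spinor_map_def)
    also have "\<dots> = Ozeta c d m * (?s m * ?g (lo + m)) - (if m = 0 then 0 else - ((-1)^m) * (?s (m - 1) * ?g (lo + m - 1)))
       + (if m < d then - ((-1)^m) * Ophi a b c d (Suc m) * (?s (Suc m) * ?g (Suc (lo + m))) else 0)"
      unfolding spinor_coeff_Y[OF f \<epsilon> l odd_n] dg lower[symmetric] upper[symmetric] by (simp only: right_diff_distrib distrib_left mult_ac)
    also have "\<dots> = OZ a b c d (spinor_map k n lo d \<epsilon> f) m"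
      using True by (auto simp: OZ_tri[OF even_d] spinor_map_def tri_def)
    finally show ?thesis .
  qed (simp add: spinor_map_def OZ_tri[OF even_d] tri_def)
qed

lemma bi_hom_spinor_pair:
  assumes U: "U \<subseteq> Mn k n" and low: "lo = 0 \<or> (\<forall>f\<in>U. \<forall>s. f (s, (lo - 1, 0, n - (lo - 1))) = 0)"
  defines "W \<equiv> twist (Omod d a b c) (cyc_aut e)"
  shows "bi_hom (bi_restrict (Mmod k n) U) (dsum W W) spinor_pair"
  unfolding bi_hom_def
proof (intro conjI allI ballI)
  show "clinear_on (carrier (bi_restrict (Mmod k n) U)) spinor_pair"
    by (simp add: clinear_on_def spinor_pair_linear)
  show "spinor_pair ` carrier (bi_restrict (Mmod k n) U) \<subseteq> carrier (dsum W W)"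
    by (auto simp: dsum_def W_def carrier_twist carrier_Omod spinor_pair_def o_def spinor_map_finvec)
  fix g f assume "f \<in> carrier (bi_restrict (Mmod k n) U)"
  then have fU: "f \<in> U" by (simp add: bi_restrict_def)
  then have f: "f \<in> Mn k n" using U by auto
  have lw: "lo = 0 \<or> spinor_coeff \<epsilon> n f (lo - 1) = 0" for \<epsilon> using low fU by (auto simp: spinor_coeff_def)
  have F: "spinor_map k n lo d \<epsilon> (act (Mmod k n) g f) = act W g (spinor_map k n lo d \<epsilon> f)" if "\<epsilon> * \<epsilon> = 1" for \<epsilon>
    using spinor_map_X[OF f that] spinor_map_Y[OF f that lw] spinor_map_Z[OF f that lw]
    by (cases g) (simp_all add: act_Mmod W_def act_twist act_Omod cyc_aut_def scal_1)
  have "act (bi_restrict (Mmod k n) U) g f = act (Mmod k n) g f" by (simp add: bi_restrict_def)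
  then show "spinor_pair (act (bi_restrict (Mmod k n) U) g f) = act (dsum W W) g (spinor_pair f)"
    by (simp add: spinor_pair_def F dsum_def case_sum_o_inj)
qed

end

end

section \<open>The automorphisms of the statement, the exponents t_i and the submodule\<close>

lemma perm123_eq: "perm123 = cyc_aut 1"
  by (auto simp: perm123_def cyc_aut_def fun_eq_iff split: gen.split)

lemma aut_comp_sign_mm: "aut_comp sign_mm perm123 = cyc_aut (-1)"
  by (auto simp: aut_comp_def sign_mm_def perm123_def cyc_aut_def fun_eq_iff split: gen.split)

lemma tval_eq:
  assumes "odd m" "2 * x = - real m"
  shows "tval x = enat m"
proof -
  have "- 2 * x = real m" using assms by simp
  then show ?thesis using assms unfolding tval_def by auto
qed

lemma tval_enatD:
  assumes "tval x = enat t"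
  shows "odd t" "2 * x = - real t"
proof -
  obtain m where "odd m" "2 * x = - real m" using assms unfolding tval_def by (auto split: if_splits)
  then show "odd t" "2 * x = - real t" using tval_eq[of m x] assms by auto
qed

lemma dunkl_coeff_nonzero:
  assumes "enat n < tval \<kappa>" "1 \<le> m" "m \<le> n"
  shows "dunkl_coeff \<kappa> m \<noteq> 0"
proof
  assume 0: "dunkl_coeff \<kappa> m = 0"
  show False
  proof (cases "even m")
    case True
    then show False using 0 assms(2) by (simp add: dunkl_coeff_def)
  next
    case False
    then have "complex_of_real (real m + 2 * \<kappa>) = 0" using 0 by (simp add: dunkl_coeff_def mult.commute)
    then have "2 * \<kappa> = - real m" by (simp only: of_real_eq_0_iff)
    then show False using tval_eq[OF False] assms by auto
  qed
qed

lemma Mn_subspace: "csubspace (Mn k n)"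
proof -
  have "Dirac k (vadd f g) = vadd (Dirac k f) (Dirac k g)" "Dirac k (scal x f) = scal x (Dirac k f)" for x f g
    by (rule vec_eqI, rename_tac s a b c, case_tac s; simp add: Dirac_C0 Dirac_C1 vec_defs algebra_simps)+
  moreover have "Dirac k vzero = vzero"
    by (rule vec_eqI, rename_tac s a b c, case_tac s; simp add: Dirac_C0 Dirac_C1 vec_defs)
  ultimately show ?thesis
    unfolding csubspace_def Mn_def Pn_def by (auto simp: vec_defs)
qed

lemma Mn_eqI:
  assumes f: "f \<in> Mn k n" and g: "g \<in> Mn k n" and nz: "\<And>m. 1 \<le> m \<Longrightarrow> m \<le> n \<Longrightarrow> dunkl_coeff (k 2) m \<noteq> 0"
    and eq: "\<And>s i. i \<le> n \<Longrightarrow> f (s, (i, 0, n - i)) = g (s, (i, 0, n - i))"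
  shows "f = g"
proof (rule vec_eqI)
  fix s a b c
  let ?h = "vadd f (scal (-1) g)"
  have h: "?h \<in> Mn k n" using f g Mn_subspace[of k n] unfolding csubspace_def by blast
  have "?h (s, (a, b, c)) = 0"
  proof (cases "a < Suc n")
    case True
    show ?thesis by (rule Mn_unique[OF h nz _ _ True]) (auto simp: vec_defs eq)
  next
    case False
    then show ?thesis using h by (auto simp: Mn_iff)
  qed
  then show "f (s, (a, b, c)) = g (s, (a, b, c))" by (simp add: vec_defs)
qed

lemma Mnx_iff:
  assumes "tval (k 1) = enat t"
  shows "f \<in> Mnx k n 1 \<longleftrightarrow> f \<in> Mn k n \<and> (\<forall>s a b c. a < t \<longrightarrow> f (s, (a, b, c)) = 0)"
  using assms by (auto simp: Mnx_def ex_def)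

lemma Mnx_submodule:
  assumes t: "tval (k 1) = enat t"
  shows "bi_submodule (Mnx k n 1) (Mmod k n)"
proof -
  have br0: "dunkl_coeff (k 1) t = 0"
  proof -
    have "complex_of_real (2 * k 1) = - of_nat t" using tval_enatD[OF t] by simp
    then show ?thesis using tval_enatD(1)[OF t] by (simp add: dunkl_coeff_def mult.commute)
  qed
  have "act (Mmod k n) g f \<in> Mnx k n 1" if f: "f \<in> Mnx k n 1" for g f
  proof -
    have z: "f (s, (a, b, c)) = 0" if "a < t" for s a b c using f that by (auto simp: Mnx_iff[of k, OF t, unfolded One_nat_def])
    \<comment> \<open>Only T_1 takes coefficients from a higher x_1-exponent, and its factor
      vanishes exactly at the step from t to t - 1.\<close>
    have z': "dunkl_coeff (k 1) (Suc a) * f (s, (Suc a, b, c)) = 0" if "a < t" for s a b c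
      using z[of "Suc a"] br0 that by (cases "Suc a = t") auto
    have "act (Mmod k n) g f (s, (a, b, c)) = 0" if a: "a < t" for s a b c
    proof (cases g)
      case GX
      show ?thesis unfolding GX act_Mmod gen.case ang_X by (simp add: z a)
    next
      case GY
      show ?thesis unfolding GY act_Mmod gen.case ang_Y z'[OF a] using a by (simp add: z)
    next
      case GZ
      show ?thesis unfolding GZ act_Mmod gen.case ang_Z z'[OF a] using a by (simp add: z)
    qed
    then show ?thesis using f act_Mmod_Mn unfolding Mnx_iff[of k, OF t] by blast
  qed
  moreover have "csubspace (Mnx k n 1)"
    using Mn_subspace[of k n] unfolding csubspace_def
    by (auto simp: Mnx_iff[of k, OF t, unfolded One_nat_def] vec_defs)
  ultimately show ?thesis
    unfolding bi_submodule_def by (auto simp: Mmod_def Mnx_def)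
qed

lemma nondeg_of_real:
  assumes "\<And>m. odd m \<Longrightarrow> m < 2 * d \<Longrightarrow> 2 * b - real d + real m \<noteq> 0"
  shows "nondeg (complex_of_real b) d"
  unfolding nondeg_def
proof (intro allI impI)
  fix m :: nat assume "odd m" "m < 2 * d"
  then have "complex_of_real (2 * b - real d + real m) \<noteq> 0" using assms by (simp only: of_real_eq_0_iff) simp
  then show "2 * complex_of_real b - of_nat d + of_nat m \<noteq> 0" by simp
qed

lemma Odelta_of_real_nonzero:
  assumes nd: "nondeg (complex_of_real b) d" and j: "1 \<le> j" "j \<le> d"
    and ev: "even j \<Longrightarrow> real d + 1 - 2 * real j - 2 * a - 2 * b - 2 * c \<noteq> 0
      \<and> 2 * b - real d - 1 + real j \<noteq> 0 \<and> 2 * b - real d - 1 + 2 * real j - 2 * a - 2 * c \<noteq> 0"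
    and od: "odd j \<Longrightarrow> real d + 1 - 2 * real j - 2 * a - 2 * b + 2 * c \<noteq> 0
      \<and> 2 * b + real j \<noteq> 0 \<and> 2 * b - real d - 1 + 2 * real j - 2 * a + 2 * c \<noteq> 0"
  shows "Odelta (complex_of_real a) (complex_of_real b) (complex_of_real c) d j \<noteq> 0"
proof -
  let ?D = "2 * complex_of_real b - of_nat d + 2 * of_nat j - 1"
  obtain i where i: "j = Suc i" using j by (cases j) auto
  have D: "?D \<noteq> 0" using nondeg_odd[OF nd, of i] j i by simp
  show ?thesis
  proof (cases "even j")
    case True
    have eq: "Odelta (complex_of_real a) (complex_of_real b) (complex_of_real c) d j
      = of_real (real j) * of_real (real d + 1 - 2 * real j - 2 * a - 2 * b - 2 * c) / 2
        * (of_real (2 * b - real d - 1 + real j) * of_real (2 * b - real d - 1 + 2 * real j - 2 * a - 2 * c) / 2) / ?D^2"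
      using True by (simp add: Odelta_def Ophi_def Opsi_def)
    show ?thesis using ev[OF True] j D unfolding eq by (simp del: of_real_add of_real_diff of_real_mult)
  next
    case False
    have eq: "Odelta (complex_of_real a) (complex_of_real b) (complex_of_real c) d j
      = of_real (real j - real d - 1) * of_real (real d + 1 - 2 * real j - 2 * a - 2 * b + 2 * c) / 2
        * (of_real (2 * b + real j) * of_real (2 * b - real d - 1 + 2 * real j - 2 * a + 2 * c) / 2) / ?D^2"
      using False by (simp add: Odelta_def Ophi_def Opsi_def)
    have "real j - real d - 1 \<noteq> 0" using j by simp
    then show ?thesis using od[OF False] D unfolding eq by (simp del: of_real_add of_real_diff of_real_mult)
  qed
qed

section \<open>The submodule and the quotient as window models\<close>

context
  fixes k :: "nat \<Rightarrow> real" and n t1 :: nat and K :: real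
  assumes odd_n: "odd n" and t1: "tval (k 1) = enat t1" and t1n: "t1 \<le> n"
    and t2: "enat n < tval (k 2)" and t3: "enat n < tval (k 3)"
    and K: "K = k 1 + k 2 + k 3"
begin

lemma t1_facts: "odd t1" "2 * k 1 = - real t1" "1 \<le> t1"
  using tval_enatD[OF t1] by (auto intro: Suc_leI odd_pos)

lemma k1_complex: "complex_of_real (k 1) = - of_nat t1 / 2"
proof -
  have "k 1 = - real t1 / 2" using t1_facts(2) by simp
  then show ?thesis by simp
qed

lemma dunkl_coeff_t1: "dunkl_coeff (k 1) t1 = 0"
  using t1_facts(1) by (simp only: dunkl_coeff_def k1_complex) simp

lemma neg1_t1: "(-1::complex)^t1 = -1"
  using t1_facts(1) by simp

text \<open>The window t_1, ..., n reaches the top degree. It starts at an odd exponent, whence the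
  sign in W_1.\<close>

lemma model1: "spinor_model k n t1 (n - t1)"
  by unfold_locales (use odd_n t1n t1_facts(1) dunkl_coeff_nonzero[OF t2] dunkl_coeff_nonzero[OF t3] in auto)

text \<open>The window 0, ..., t_1 - 1 ends where T_1 annihilates the next power x_1^t_1.\<close>

lemma model2: "spinor_model k n 0 (t1 - 1)"
  by unfold_locales (use odd_n t1n t1_facts dunkl_coeff_nonzero[OF t2] dunkl_coeff_nonzero[OF t3] dunkl_coeff_t1 in auto)

lemma W1_hom:
  "bi_hom (bi_restrict (Mmod k n) (Mnx k n 1))
     (dsum (twist (Omod (n - t1) (complex_of_real (k 2 + (real n + 1) / 2)) (complex_of_real (- K - (real n + 1) / 2))
              (complex_of_real (- k 3 - (real n + 1) / 2))) (cyc_aut (-1)))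
           (twist (Omod (n - t1) (complex_of_real (k 2 + (real n + 1) / 2)) (complex_of_real (- K - (real n + 1) / 2))
              (complex_of_real (- k 3 - (real n + 1) / 2))) (cyc_aut (-1))))
     (spinor_model.spinor_pair k n t1 (n - t1))"
proof (rule spinor_model.bi_hom_spinor_pair[OF model1])
  show "-1 = (-1::complex)^t1" by (simp add: neg1_t1)
  have nt: "complex_of_nat (n - t1) = of_nat n - of_nat t1" using t1n by (simp add: of_nat_diff)
  fix m
  show "Oth (complex_of_real (k 2 + (real n + 1) / 2)) (n - t1) m
      = (-1)^m * (of_nat (t1 + m) + complex_of_real (k 1) + complex_of_real (k 2) + 1/2)"
    by (simp add: Oth_def nt k1_complex k1_complex[unfolded One_nat_def] field_simps)
  show "Oth (complex_of_real (- K - (real n + 1) / 2)) (n - t1) m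
      = - ((-1)^m) * (of_nat (n - (t1 + m)) + complex_of_real (k 2) + complex_of_real (k 3) + 1/2)" if "m \<le> n - t1"
    using that t1n by (simp add: Oth_def nt k1_complex k1_complex[unfolded One_nat_def] K field_simps of_nat_diff)
  show "Ophi (complex_of_real (k 2 + (real n + 1) / 2)) (complex_of_real (- K - (real n + 1) / 2))
       (complex_of_real (- k 3 - (real n + 1) / 2)) (n - t1) (Suc m) = dunkl_coeff (k 1) (Suc (t1 + m)) * dunkl_coeff (k 3) (n - (t1 + m))"
    if m: "Suc m \<le> n - t1"
  proof -
    \<comment> \<open>Removes the truncated subtractions; as n and t_1 are odd, r and m have equal
      parity, so one case split fixes all signs.\<close>
    obtain r where r: "n = t1 + m + r" using m t1n by (metis Suc_leD le_Suc_ex le_diff_conv2 add.commute)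
    have "even r \<longleftrightarrow> even m" using odd_n t1_facts(1) r by auto
    then show ?thesis using t1_facts(1)
      by (cases "even m") (simp_all add: Ophi_def dunkl_coeff_def r k1_complex k1_complex[unfolded One_nat_def] K field_simps)
  qed
next
  show "complex_of_real (- k 3 - (real n + 1) / 2) + (of_nat (n - t1) + 1) / 2
      = -1 * (complex_of_real (k 3) - complex_of_real (k 1))"
    using t1n by (simp add: k1_complex[unfolded One_nat_def] of_nat_diff field_simps)
  show "Mnx k n 1 \<subseteq> Mn k n" by (auto simp: Mnx_def)
  show "t1 = 0 \<or> (\<forall>f\<in>Mnx k n 1. \<forall>s. f (s, (t1 - 1, 0, n - (t1 - 1))) = 0)"
    using t1_facts(3) by (auto simp: Mnx_iff[of k, OF t1, unfolded One_nat_def])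
qed

lemma W2_hom:
  "bi_hom (bi_restrict (Mmod k n) (Mn k n))
     (dsum (twist (Omod (t1 - 1) (complex_of_real (k 2)) (complex_of_real (- K - real n - 1)) (complex_of_real (k 3))) (cyc_aut 1))
           (twist (Omod (t1 - 1) (complex_of_real (k 2)) (complex_of_real (- K - real n - 1)) (complex_of_real (k 3))) (cyc_aut 1)))
     (spinor_model.spinor_pair k n 0 (t1 - 1))"
proof (rule spinor_model.bi_hom_spinor_pair[OF model2])
  have t: "complex_of_nat (t1 - 1) = of_nat t1 - 1" using t1_facts(3) by (simp add: of_nat_diff)
  have t': "complex_of_nat (t1 - Suc 0) = of_nat t1 - 1" using t by simp
  fix m
  show "Oth (complex_of_real (k 2)) (t1 - 1) m
      = (-1)^m * (of_nat (0 + m) + complex_of_real (k 1) + complex_of_real (k 2) + 1/2)"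
    by (simp add: Oth_def t t' k1_complex k1_complex[unfolded One_nat_def] field_simps)
  show "Oth (complex_of_real (- K - real n - 1)) (t1 - 1) m
      = - ((-1)^m) * (of_nat (n - (0 + m)) + complex_of_real (k 2) + complex_of_real (k 3) + 1/2)" if "m \<le> t1 - 1"
    using that t1n by (simp add: Oth_def t t' k1_complex k1_complex[unfolded One_nat_def] K field_simps of_nat_diff)
  show "Ophi (complex_of_real (k 2)) (complex_of_real (- K - real n - 1)) (complex_of_real (k 3)) (t1 - 1) (Suc m)
     = dunkl_coeff (k 1) (Suc (0 + m)) * dunkl_coeff (k 3) (n - (0 + m))"
    if m: "Suc m \<le> t1 - 1"
  proof -
    obtain r where r: "n = m + r" using m t1n by (metis Suc_leD diff_le_self le_Suc_ex le_trans)
    have "even r \<longleftrightarrow> odd m" using odd_n r by auto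
    then show ?thesis using t1_facts(1)
      by (cases "even m") (simp_all add: Ophi_def dunkl_coeff_def r t t' k1_complex k1_complex[unfolded One_nat_def] K field_simps)
  qed
next
  show "complex_of_real (k 3) + (of_nat (t1 - 1) + 1) / 2 = 1 * (complex_of_real (k 3) - complex_of_real (k 1))"
    using t1_facts(3) by (simp add: k1_complex[unfolded One_nat_def] of_nat_diff field_simps)
qed auto

lemma iso_part:
  "bi_iso (bi_restrict (Mmod k n) (Mnx k n 1))
     (dsum (twist (Omod (n - t1) (complex_of_real (k 2 + (real n + 1) / 2)) (complex_of_real (- K - (real n + 1) / 2))
              (complex_of_real (- k 3 - (real n + 1) / 2))) (cyc_aut (-1)))
           (twist (Omod (n - t1) (complex_of_real (k 2 + (real n + 1) / 2)) (complex_of_real (- K - (real n + 1) / 2))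
              (complex_of_real (- k 3 - (real n + 1) / 2))) (cyc_aut (-1))))" (is "bi_iso ?M (dsum ?W ?W)")
proof -
  interpret spinor_model k n t1 "n - t1" by (rule model1)
  have cM: "carrier ?M = Mnx k n 1" by (simp add: bi_restrict_def)
  have cN: "carrier (dsum ?W ?W) = {w. w \<circ> Inl \<in> finvec (n - t1) \<and> w \<circ> Inr \<in> finvec (n - t1)}"
    by (simp add: dsum_def carrier_twist carrier_Omod)
  have "inj_on spinor_pair (Mnx k n 1)"
  proof (rule inj_onI)
    fix f g assume f: "f \<in> Mnx k n 1" and g: "g \<in> Mnx k n 1" and eq: "spinor_pair f = spinor_pair g"
    show "f = g"
    proof (rule Mn_eqI[where k = k and n = n])
      fix s i assume "i \<le> n"
      then show "f (s, (i, 0, n - i)) = g (s, (i, 0, n - i))"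
        using f g spinor_pair_eqD[OF eq, of i] t1n by (cases "i < t1") (auto simp: Mnx_iff[of k, OF t1, unfolded One_nat_def])
    qed (use f g nz2 in \<open>auto simp: Mnx_iff[of k, OF t1, unfolded One_nat_def]\<close>)
  qed
  moreover have "w \<in> spinor_pair ` Mnx k n 1" if w: "w \<in> carrier (dsum ?W ?W)" for w
  proof -
    obtain f where f: "f \<in> Mn k n" "spinor_pair f = w"
      "\<And>s i. i \<le> n \<Longrightarrow> i < t1 \<or> t1 + (n - t1) < i \<Longrightarrow> f (s, (i, 0, n - i)) = 0"
      using spinor_pair_surj[of w] w unfolding cN by blast
    \<comment> \<open>The constructed f vanishes below t_1 only on the slice x_2 = 0. Because T_1
      kills x_1^t_1, the vanishing spreads to all powers of x_2.\<close>
    have "f (s, (a, b, c)) = 0" if "a < t1" for s a b c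
      by (rule Mn_unique[OF f(1) nz2 _ _ that]) (use dunkl_coeff_t1 f(3) t1n in auto)
    then show ?thesis using f by (auto simp: Mnx_iff[of k, OF t1, unfolded One_nat_def])
  qed
  moreover have "spinor_pair ` Mnx k n 1 \<subseteq> carrier (dsum ?W ?W)"
    using W1_hom unfolding bi_hom_def cM by blast
  ultimately have "bij_betw spinor_pair (carrier ?M) (carrier (dsum ?W ?W))"
    unfolding bij_betw_def cM by blast
  then show ?thesis using W1_hom unfolding bi_iso_def by blast
qed

lemma quot_part:
  "bi_quot_iso (Mmod k n) (Mnx k n 1)
     (dsum (twist (Omod (t1 - 1) (complex_of_real (k 2)) (complex_of_real (- K - real n - 1)) (complex_of_real (k 3))) (cyc_aut 1))
           (twist (Omod (t1 - 1) (complex_of_real (k 2)) (complex_of_real (- K - real n - 1)) (complex_of_real (k 3))) (cyc_aut 1)))"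
    (is "bi_quot_iso ?M _ (dsum ?W ?W)")
proof -
  interpret spinor_model k n 0 "t1 - 1" by (rule model2)
  have cM: "carrier ?M = Mn k n" by (simp add: Mmod_def)
  have rM: "bi_restrict ?M (Mn k n) = ?M" by (simp add: bi_restrict_def Mmod_def)
  note hom = W2_hom[unfolded rM]
  have cN: "carrier (dsum ?W ?W) = {w. w \<circ> Inl \<in> finvec (t1 - 1) \<and> w \<circ> Inr \<in> finvec (t1 - 1)}"
    by (simp add: dsum_def carrier_twist carrier_Omod)
  have "spinor_pair ` carrier ?M = carrier (dsum ?W ?W)"
  proof
    show "spinor_pair ` carrier ?M \<subseteq> carrier (dsum ?W ?W)" using hom by (simp add: bi_hom_def)
    show "carrier (dsum ?W ?W) \<subseteq> spinor_pair ` carrier ?M"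
      using spinor_pair_surj unfolding cN cM by blast
  qed
  moreover have "{v \<in> carrier ?M. spinor_pair v = vzero} = Mnx k n 1"
  proof (intro equalityI subsetI)
    fix f assume "f \<in> {v \<in> carrier ?M. spinor_pair v = vzero}"
    then have f: "f \<in> Mn k n" and G0: "spinor_pair f = vzero" by (auto simp: cM)
    have "spinor_pair vzero = vzero"
      using spinor_pair_linear(2)[of 0 vzero] by (simp add: vec_defs)
    then have eq: "spinor_pair f = spinor_pair vzero" using G0 by simp
    \<comment> \<open>The map sees only the exponents below t_1 on the slice, and these already
      control the coefficients below t_1 everywhere.\<close>
    have "f (s, (a, b, c)) = 0" if "a < t1" for s a b c
    proof (rule Mn_unique[OF f nz2 _ _ that])
      show "f (s, (i, 0, n - i)) = 0" if "i < t1" for s i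
        using spinor_pair_eqD[OF eq, of i s] that by (simp add: vzero_def)
    qed (use dunkl_coeff_t1 in auto)
    then show "f \<in> Mnx k n 1" using f by (simp add: Mnx_iff[of k, OF t1, unfolded One_nat_def])
  next
    fix f assume f: "f \<in> Mnx k n 1"
    then have F: "spinor_map k n 0 (t1 - 1) \<epsilon> f = vzero" for \<epsilon>
      using t1_facts(3) by (auto simp: spinor_map_def spinor_coeff_def vzero_def Mnx_iff[of k, OF t1, unfolded One_nat_def] fun_eq_iff)
    have "spinor_pair f = vzero" unfolding spinor_pair_def F by (auto simp: vzero_def fun_eq_iff split: sum.split)
    then show "f \<in> {v \<in> carrier ?M. spinor_pair v = vzero}" using f by (simp add: cM Mnx_def)
  qed
  ultimately show ?thesis
    unfolding bi_quot_iso_def using hom Mnx_submodule[of k, OF t1] by blast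
qed

section \<open>Irreducibility and untwisting for nonnegative k_2 and k_3\<close>

context
  assumes k2: "k 2 \<ge> 0" and k3: "k 3 \<ge> 0"
begin

lemma real_bounds: "real t1 \<le> real n" "1 \<le> real t1" "real (n - t1) = real n - real t1" "real (t1 - 1) = real t1 - 1"
  "2 * k 1 = - real t1" "2 * K = 2 * k 2 + 2 * k 3 - real t1"
  using t1n t1_facts by (auto simp: of_nat_diff K)

text \<open>The quantity equals m - 2 (n - t_1) - 1 - 2 k_2 - 2 k_3, which is negative in the given
  range.\<close>

lemma nondeg1: "nondeg (complex_of_real (- K - (real n + 1) / 2)) (n - t1)"
proof (rule nondeg_of_real)
  fix m assume "m < 2 * (n - t1)"
  then have "real m < real (2 * (n - t1))" by (simp only: of_nat_less_iff)
  then have "real m < 2 * (real n - real t1)" using real_bounds(3) by simp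
  then show "2 * (- K - (real n + 1) / 2) - real (n - t1) + real m \<noteq> 0"
    using real_bounds k2 k3 by (simp add: field_simps)
qed

text \<open>The quantities are m - 2 n - 1 - 2 k_2 - 2 k_3 < 0 and m + 2 (n - t_1) + 3 + 2 k_2 + 2
  k_3 > 0.\<close>

lemma nondeg2:
  "nondeg (complex_of_real (- K - real n - 1)) (t1 - 1)" "nondeg (- complex_of_real (- K - real n - 1)) (t1 - 1)"
proof -
  show "nondeg (complex_of_real (- K - real n - 1)) (t1 - 1)"
  proof (rule nondeg_of_real)
    fix m assume "m < 2 * (t1 - 1)"
    then have "real m < real (2 * (t1 - 1))" by (simp only: of_nat_less_iff)
    then have "real m < 2 * (real t1 - 1)" using real_bounds(4) by simp
    then show "2 * (- K - real n - 1) - real (t1 - 1) + real m \<noteq> 0"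
      unfolding real_bounds(4) using real_bounds(1,2,5,6) k2 k3 by argo
  qed
  have "nondeg (complex_of_real (- (- K - real n - 1))) (t1 - 1)"
  proof (rule nondeg_of_real)
    fix m :: nat
    have "real m \<ge> 0" by simp
    then show "2 * (- (- K - real n - 1)) - real (t1 - 1) + real m \<noteq> 0"
      unfolding real_bounds(4) using real_bounds(1,2,5,6) k2 k3 by argo
  qed
  then show "nondeg (- complex_of_real (- K - real n - 1)) (t1 - 1)" by simp
qed

text \<open>After inserting 2 k_1 = -t_1 every linear factor has a fixed sign. With d = n - t_1, for
  even j they include 4 k_3 + 2 (d + 1 - j) > 0 and -4 k_2 - 2 (d + 1 - j) < 0, and for odd j -2
  (t_1 + j) < 0.\<close>

lemma Odelta_W1:
  assumes "1 \<le> j" "j \<le> n - t1"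
  shows "Odelta (complex_of_real (k 2 + (real n + 1) / 2)) (complex_of_real (- K - (real n + 1) / 2))
    (complex_of_real (- k 3 - (real n + 1) / 2)) (n - t1) j \<noteq> 0"
proof (rule Odelta_of_real_nonzero[OF nondeg1 assms])
  have j: "1 \<le> real j" "real j \<le> real n - real t1" using assms real_bounds(3) by linarith+
  show "real (n - t1) + 1 - 2 * real j - 2 * (k 2 + (real n + 1) / 2) - 2 * (- K - (real n + 1) / 2)
      - 2 * (- k 3 - (real n + 1) / 2) \<noteq> 0
    \<and> 2 * (- K - (real n + 1) / 2) - real (n - t1) - 1 + real j \<noteq> 0
    \<and> 2 * (- K - (real n + 1) / 2) - real (n - t1) - 1 + 2 * real j - 2 * (k 2 + (real n + 1) / 2)
      - 2 * (- k 3 - (real n + 1) / 2) \<noteq> 0"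
    unfolding real_bounds(3,4) by (intro conjI notI) (use j real_bounds(1,2,5,6) k2 k3 in argo)+
  show "real (n - t1) + 1 - 2 * real j - 2 * (k 2 + (real n + 1) / 2) - 2 * (- K - (real n + 1) / 2)
      + 2 * (- k 3 - (real n + 1) / 2) \<noteq> 0
    \<and> 2 * (- K - (real n + 1) / 2) + real j \<noteq> 0
    \<and> 2 * (- K - (real n + 1) / 2) - real (n - t1) - 1 + 2 * real j - 2 * (k 2 + (real n + 1) / 2)
      + 2 * (- k 3 - (real n + 1) / 2) \<noteq> 0"
    unfolding real_bounds(3,4) by (intro conjI notI) (use j real_bounds(1,2,5,6) k2 k3 in argo)+
qed

lemma Odelta_W2:
  assumes "1 \<le> j" "j \<le> t1 - 1"
  shows "Odelta (complex_of_real (k 2)) (complex_of_real (- K - real n - 1)) (complex_of_real (k 3)) (t1 - 1) j \<noteq> 0"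
proof (rule Odelta_of_real_nonzero[OF nondeg2(1) assms])
  have j: "1 \<le> real j" "real j \<le> real t1 - 1" using assms real_bounds(4) by linarith+
  show "real (t1 - 1) + 1 - 2 * real j - 2 * k 2 - 2 * (- K - real n - 1) - 2 * k 3 \<noteq> 0
    \<and> 2 * (- K - real n - 1) - real (t1 - 1) - 1 + real j \<noteq> 0
    \<and> 2 * (- K - real n - 1) - real (t1 - 1) - 1 + 2 * real j - 2 * k 2 - 2 * k 3 \<noteq> 0"
    unfolding real_bounds(3,4) by (intro conjI notI) (use j real_bounds(1,2,5,6) k2 k3 in argo)+
  show "real (t1 - 1) + 1 - 2 * real j - 2 * k 2 - 2 * (- K - real n - 1) + 2 * k 3 \<noteq> 0
    \<and> 2 * (- K - real n - 1) + real j \<noteq> 0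
    \<and> 2 * (- K - real n - 1) - real (t1 - 1) - 1 + 2 * real j - 2 * k 2 + 2 * k 3 \<noteq> 0"
    unfolding real_bounds(3,4) by (intro conjI notI) (use j real_bounds(1,2,5,6) k2 k3 in argo)+
qed

lemma even_dims: "even (n - t1)" "even (t1 - 1)"
  using odd_n t1_facts(1) t1n by auto

lemma irreducible_part:
  "bi_irreducible (twist (Omod (n - t1) (complex_of_real (k 2 + (real n + 1) / 2)) (complex_of_real (- K - (real n + 1) / 2))
      (complex_of_real (- k 3 - (real n + 1) / 2))) (cyc_aut (-1)))"
  "bi_irreducible (twist (Omod (t1 - 1) (complex_of_real (k 2)) (complex_of_real (- K - real n - 1)) (complex_of_real (k 3))) (cyc_aut 1))"
  by (rule bi_irreducible_cyc_aut[OF even_dims(1) nondeg1 _ Odelta_W1]; simp)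
    (rule bi_irreducible_cyc_aut[OF even_dims(2) nondeg2(1) _ Odelta_W2]; simp)

lemma iso_O_part:
  "bi_iso (twist (Omod (n - t1) (complex_of_real (k 2 + (real n + 1) / 2)) (complex_of_real (- K - (real n + 1) / 2))
      (complex_of_real (- k 3 - (real n + 1) / 2))) (cyc_aut (-1)))
    (Omod (n - t1) (complex_of_real (K + (real n + 1) / 2)) (complex_of_real (- k 3 - (real n + 1) / 2))
      (complex_of_real (- k 2 - (real n + 1) / 2)))"
  "bi_iso (twist (Omod (t1 - 1) (complex_of_real (k 2)) (complex_of_real (- K - real n - 1)) (complex_of_real (k 3))) (cyc_aut 1))
    (Omod (t1 - 1) (complex_of_real (- K - real n - 1)) (complex_of_real (k 3)) (complex_of_real (k 2)))"
proof -
  have m: "complex_of_real (K + (real n + 1) / 2) = - complex_of_real (- K - (real n + 1) / 2)"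
    "complex_of_real (- k 2 - (real n + 1) / 2) = - complex_of_real (k 2 + (real n + 1) / 2)"
    by simp_all
  show "bi_iso (twist (Omod (n - t1) (complex_of_real (k 2 + (real n + 1) / 2)) (complex_of_real (- K - (real n + 1) / 2))
      (complex_of_real (- k 3 - (real n + 1) / 2))) (cyc_aut (-1)))
    (Omod (n - t1) (complex_of_real (K + (real n + 1) / 2)) (complex_of_real (- k 3 - (real n + 1) / 2))
      (complex_of_real (- k 2 - (real n + 1) / 2)))"
    unfolding m by (rule bi_iso_cyc_aut_minus[OF even_dims(1) nondeg1 Odelta_W1])
  show "bi_iso (twist (Omod (t1 - 1) (complex_of_real (k 2)) (complex_of_real (- K - real n - 1)) (complex_of_real (k 3))) (cyc_aut 1))
    (Omod (t1 - 1) (complex_of_real (- K - real n - 1)) (complex_of_real (k 3)) (complex_of_real (k 2)))"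
    by (rule bi_iso_cyc_aut_plus[OF even_dims(2) nondeg2 Odelta_W2])
qed

end

end

theorem theorem7p4:
  fixes k :: "nat \<Rightarrow> real" and n t1 :: nat
  assumes "odd n"
    and "tval (k 1) = enat t1" and "t1 \<le> n"
    and "enat n < tval (k 2)" and "enat n < tval (k 3)"
  defines "K \<equiv> k 1 + k 2 + k 3"
  defines "W1 \<equiv> twist (Omod (n - t1) (complex_of_real (k 2 + (real n + 1) / 2))
                                     (complex_of_real (- K - (real n + 1) / 2))
                                     (complex_of_real (- k 3 - (real n + 1) / 2)))
                      (aut_comp sign_mm perm123)"
  defines "W2 \<equiv> twist (Omod (t1 - 1) (complex_of_real (k 2)) (complex_of_real (- K - real n - 1))
                                     (complex_of_real (k 3)))
                      perm123"
  shows "bi_iso (bi_restrict (Mmod k n) (Mnx k n 1)) (dsum W1 W1)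
       \<and> bi_quot_iso (Mmod k n) (Mnx k n 1) (dsum W2 W2)
       \<and> (k 2 \<ge> 0 \<and> k 3 \<ge> 0 \<longrightarrow>
            bi_irreducible W1 \<and> bi_irreducible W2
          \<and> bi_iso W1 (Omod (n - t1) (complex_of_real (K + (real n + 1) / 2))
                                     (complex_of_real (- k 3 - (real n + 1) / 2))
                                     (complex_of_real (- k 2 - (real n + 1) / 2)))
          \<and> bi_iso W2 (Omod (t1 - 1) (complex_of_real (- K - real n - 1))
                                     (complex_of_real (k 3)) (complex_of_real (k 2))))"
proof -
  have K: "K = k 1 + k 2 + k 3" by (simp add: K_def)
  note ctx = assms(1-5) K
  show ?thesis
    unfolding W1_def W2_def aut_comp_sign_mm unfolding perm123_eq
    by (intro conjI impI iso_part[OF ctx] quot_part[OF ctx] irreducible_part[OF ctx] iso_O_part[OF ctx];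
        elim conjE; assumption)
qed

end
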